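(* Let $p+q=1$, $0\le p\le1$, $n\ge1$. Let $V\in C^2(\mathbb{R}\setminus\{0\},\mathbb{R}_+)$ satisfy $V(u)=V(-u)$, $\mathrm{supp}\,V=[-1,1]$, $V'(u)\le0$ for $u>0$, and $\lim_{u\to0}|u|^\delta V(u)>0$ for some $\delta>0$; set $V_\epsilon(u)=V(u/\epsilon)$. On one probability space with independent standard Brownian motions $B_0,\dots,B_n$, let $x^\epsilon(t)\in\mathbb{W}_{n+1}^+$ solve $$\mathrm{d}x^\epsilon_j=\big(pV_\epsilon'(x^\epsilon_{j+1}-x^\epsilon_j)-qV_\epsilon'(x^\epsilon_j-x^\epsilon_{j-1})\big)\mathrm{d}t+\mathrm{d}B_j,\quad j=0,\dots,n,$$ with the convention that the term involving $x^\epsilon_{-1}$ (for $j=0$) and the term involving $x^\epsilon_{n+1}$ (for $j=n$) are absent, and let $y(t)\in\mathbb{W}_{n+1}^+$ solve $$y_j(t)=y_j+B_j(t)-p\Lambda^{(j,j+1)}(t)+q\Lambda^{(j-1,j)}(t),\quad j=0,\dots,n,$$ with $\Lambda^{(j,j+1)}(t)$ the right-sided local time at $0$ of $y_{j+1}-y_j$ on $[0,t]$ and $\Lambda^{(-1,0)}=\Lambda^{(n,n+1)}=0$. If $x^\epsilon(0)=y(0)\in\mathbb{W}_{n+1}^+$, then for every $t\ge0$ $$\lim_{\epsilon\to0}\mathbb{E}\big((x^\epsilon(t)-y(t))^2\big)=0.$$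
   Context: $\mathbb{W}_{n+1}^+=\{x=(x_0,\dots,x_n)\in\mathbb{R}^{n+1}:x_0\le x_1\le\dots\le x_n\}$; $(x^\epsilon(t)-y(t))^2$ denotes the squared Euclidean norm. The potential is entrance–no exit, so $x^\epsilon(t)\in\mathbb{W}_{n+1}^+$ almost surely. *)

theory Defs
  imports "HOL-Probability.Probability"
begin

definition weyl_chamber :: "nat \<Rightarrow> (nat \<Rightarrow> real) set" where
  "weyl_chamber n = {x. \<forall>j<n. x j \<le> x (Suc j)}"

definition indep_std_BMs ::
  "'a measure \<Rightarrow> nat \<Rightarrow> (nat \<Rightarrow> real \<Rightarrow> 'a \<Rightarrow> real) \<Rightarrow> bool" where
  "indep_std_BMs M n B \<longleftrightarrow>
     (\<forall>j\<le>n. \<forall>t. B j t \<in> borel_measurable M) \<and>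
     (\<forall>j\<le>n. \<forall>\<omega>\<in>space M. B j 0 \<omega> = 0 \<and> continuous_on {0..} (\<lambda>t. B j t \<omega>)) \<and>
     (\<forall>ts :: nat \<Rightarrow> real. \<forall>k. 0 \<le> ts 0 \<and> (\<forall>i<k. ts i < ts (Suc i)) \<longrightarrow>
        prob_space.indep_vars M (\<lambda>_. borel)
          (\<lambda>ji \<omega>. B (fst ji) (ts (Suc (snd ji))) \<omega> - B (fst ji) (ts (snd ji)) \<omega>) ({..n} \<times> {..<k}) \<and>
        (\<forall>j\<le>n. \<forall>i<k. distributed M lborel (\<lambda>\<omega>. B j (ts (Suc i)) \<omega> - B j (ts i) \<omega>)
             (\<lambda>z. ennreal (normal_density 0 (sqrt (ts (Suc i) - ts i)) z))))"

text \<open>Right-sided local time at 0 on [0,t] of the path Z = y_{j+1} - y_j, via the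
  occupation-time formula Lambda(t) = lim_{e->0+} (1/(2e)) int_0^t 1{0 <= Z_s < e} d<Z>_s,
  where, for the processes under consideration, d<Z>_s = 2 ds.  (This is the
  normalisation for which the y-equation keeps y in the Weyl chamber, i.e. the
  Skorokhod regulator.)\<close>
definition is_right_local_time_0 :: "(real \<Rightarrow> real) \<Rightarrow> real \<Rightarrow> real \<Rightarrow> bool" where
  "is_right_local_time_0 Z t L \<longleftrightarrow>
     ((\<lambda>e. measure lborel {s \<in> {0..t}. 0 \<le> Z s \<and> Z s < e} / e) \<longlongrightarrow> L) (at_right 0)"

end

(* Both gap processes solve a Skorokhod problem driven by the same path: the local times push a gap
   only while it vanishes, the integrated repulsion A_j = - int V_eps'(x_(j+1) - x_j) ds only while
   the gap is at most eps.  The one-dimensional Skorokhod map is Lipschitz for the supremum norm,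
   and the coupling matrix with entries p, q off the diagonal is tamed by a superharmonic weight.
   So |x^eps - y| <= C eps almost surely, with a deterministic constant C.

   The HOL value of V_eps' at the singularity 0 is an unspecified number.  It is harmless
   because the gaps of x^eps vanish only on a Lebesgue null set of times.  This is shown pathwise,
   without adaptedness: a gap is a Brownian path plus an absolutely continuous one, and Brownian
   increments over a small h are rarely as small as K h. *)

theory Submission
  imports Defs
begin

text \<open>A direct estimate on V_eps' is hopeless: it blows up at contact and as eps tends to 0.
  Once its integrals are treated as regulators, the potential acts through two facts: its derivative
  has a sign on positive gaps and vanishes beyond eps. What remains is to close the system of
  inequalities between neighbouring gaps. The rows of the coupling matrix sum to at most p + q = 1,
  with equality in the interior of the chain, so the plain supremum norm yields no contraction; the
  loss sits at the ends. The weight is a supersolution of u_j = 1 + p u_(j+1) + q u_(j-1) with value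
  0 outside the chain, the equation for the expected exit time of a walk on {0..n-1} stepping right
  with probability p and left with probability q. An explicit choice is 4^n - 4^j when the walk
  drifts right or is symmetric, and its mirror image otherwise. The null zero set serves the
  monotonicity of A_j: the density of A_j is nonnegative at positive gaps, but has an unknown sign
  at contact.\<close>

subsection \<open>Stability of the Skorokhod problem\<close>

text \<open>Compare at the last time before \<open>t\<close> at which \<open>X + A \<le> e\<close>; from then on \<open>A\<close> is constant.\<close>
lemma skorokhod_comparison:
  fixes X A X' A' :: "real \<Rightarrow> real"
  assumes t: "0 \<le> t" and e: "0 \<le> e" and d: "0 \<le> d"
    and contG: "continuous_on {0..t} (\<lambda>s. X s + A s)" and contA: "continuous_on {0..t} A"
    and A0: "A 0 = 0"
    and flat: "\<And>s r. \<lbrakk>0 \<le> s; s \<le> r; r \<le> t; \<And>v. v \<in> {s..r} \<Longrightarrow> e < X v + A v\<rbrakk> \<Longrightarrow> A r = A s"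
    and A'0: "A' 0 = 0" and mono: "mono_on {0..t} A'"
    and nonneg: "\<And>s. s \<in> {0..t} \<Longrightarrow> 0 \<le> X' s + A' s"
    and close: "\<And>s. s \<in> {0..t} \<Longrightarrow> X' s \<le> X s + d"
  shows "A t \<le> A' t + d + e"
proof (cases "\<exists>s\<in>{0..t}. X s + A s \<le> e")
  case False
  then have "A t = A 0"
    by (intro flat) (use t in \<open>auto simp: not_le\<close>)
  moreover have "A' 0 \<le> A' t"
    using mono t by (auto intro: mono_onD)
  ultimately show ?thesis using A0 A'0 e d by simp
next
  case True
  let ?S = "{s \<in> {0..t}. X s + A s \<le> e}"
  have "closed ?S"
    using continuous_closed_preimage[OF contG, of "{..e}"] by (simp add: vimage_def Int_def)
  then have "compact ?S"
    by (metis (no_types, lifting) bounded_closed_interval bounded_subset compact_eq_bounded_closed mem_Collect_eq subsetI)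
  moreover have "?S \<noteq> {}" using True by auto
  ultimately obtain \<tau> where \<tau>: "\<tau> \<in> ?S" "\<And>s. s \<in> ?S \<Longrightarrow> s \<le> \<tau>"
    using compact_attains_sup[of ?S] by blast
  \<comment> \<open>\<open>flat\<close> asks for a strict inequality on a closed interval and so
    cannot start at \<open>\<tau>\<close>, where the gap is at most \<open>e\<close>. Constancy is
    shown on the half-open interval and carried to \<open>\<tau>\<close> by continuity of
    \<open>A\<close>.\<close>
  have eq: "A t = A \<tau>"
  proof (cases "\<tau> = t")
    case False
    with \<tau> have lt: "\<tau> < t" by auto
    have "A v = A t" if "v \<in> {\<tau><..t}" for v
    proof -
      have "A t = A v"
      proof (rule flat)
        fix r assume r: "r \<in> {v..t}"
        show "e < X r + A r"
        proof (rule ccontr)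
          assume "\<not> e < X r + A r"
          then have "r \<le> \<tau>" using r that \<tau> by (intro \<tau>(2)) auto
          then show False using r that by auto
        qed
      qed (use that \<tau> in auto)
      then show ?thesis by simp
    qed
    note const = this
    have cl: "closure {\<tau><..t} = {\<tau>..t}"
      using lt by (rule closure_greaterThanAtMost)
    have contA': "continuous_on (closure {\<tau><..t}) A"
      unfolding cl using \<tau> by (intro continuous_on_subset[OF contA]) auto
    have "A \<tau> = A t"
      by (rule continuous_constant_on_closure[OF contA' const]) (use lt in \<open>auto simp: cl\<close>)
    then show ?thesis by simp
  qed simp
  have "A' \<tau> \<le> A' t"
    using mono \<tau> t by (auto intro: mono_onD)
  moreover have "A \<tau> \<le> e - X \<tau>" using \<tau> by auto
  moreover have "0 \<le> X' \<tau> + A' \<tau>" "X' \<tau> \<le> X \<tau> + d" using nonneg close \<tau> by auto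
  ultimately show ?thesis using eq by linarith
qed

text \<open>The weights turn the coupled inequalities
  \<open>D j \<le> e + p D (j + 1) + q D (j - 1)\<close> into \<open>D j \<le> e u j\<close>, by the maximum principle for \<open>D / u\<close>.\<close>
lemma superharmonic_weights:
  fixes p q :: real
  assumes "p + q = 1" "0 \<le> p" "p \<le> 1"
  obtains u :: "nat \<Rightarrow> real" where "\<And>j. j < n \<Longrightarrow> 0 < u j"
    and "\<And>j. j < n \<Longrightarrow> 1 + (if Suc j < n then p * u (Suc j) else 0)
                          + (if 0 < j then q * u (j - 1) else 0) \<le> u j"
proof -
  \<comment> \<open>Here \<open>a\<close> is the larger of the two probabilities. The weight
    vanishes at \<open>n\<close>, so a missing right neighbour needs no separate case. For
    \<open>j = Suc k\<close> the claim reduces to 1 <= (15 a - 3) 4^k; the bracket is 16 a + (1 - a)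
    - 4, which increases in \<open>a\<close> and equals (4 - 1)^2 / 2 at a = 1/2.\<close>
  have *: "1 + (if Suc j < n then a * (4^n - 4^Suc j) else 0)
            + (if 0 < j then b * (4^n - 4^(j-1)) else 0) \<le> (4^n - 4^j :: real)"
    if ab: "a + b = 1" "1/2 \<le> a" "0 \<le> b" and j: "j < n" for a b :: real and j
  proof -
    have b: "b = 1 - a" "a \<le> 1" using ab by auto
    have drop: "(if Suc j < n then a * (4^n - 4^Suc j) else 0) = a * (4^n - 4^Suc j)"
      using j by (cases "Suc j = n") auto
    have pos: "(4::real)^Suc j \<le> 4^n" using j by (intro power_increasing) auto
    show ?thesis
    proof (cases j)
      case 0
      have "(1 - a) * 4 \<le> (1 - a) * 4 ^ n"
        using pos 0 b by (intro mult_left_mono) auto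
      then show ?thesis unfolding drop using 0 by (simp add: algebra_simps)
    next
      case (Suc k)
      have "1 * 1 \<le> (15 * a - 3) * (4::real)^k"
        using ab by (intro mult_mono) auto
      then show ?thesis unfolding drop b using Suc by (simp add: algebra_simps)
    qed
  qed
  show ?thesis
  proof (cases "1/2 \<le> p")
    case True
    show ?thesis
      using True assms by (intro that[of "\<lambda>j. 4^n - 4^j"] *) (auto intro: power_strict_increasing)
  next
    case False
    \<comment> \<open>Mirror image, j replaced by n - 1 - j, which exchanges \<open>p\<close> and
      \<open>q\<close>. The right end \<open>Suc j = n\<close> becomes index 0 of
      \<open>*\<close>.\<close>
    have "1 + (if Suc j < n then p * (4^n - 4^(n - Suc (Suc j))) else 0)
            + (if 0 < j then q * (4^n - 4^(n - Suc (j-1))) else 0) \<le> (4^n - 4^(n - Suc j) :: real)"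
      if "j < n" for j
    proof (cases "Suc j < n")
      case True
      then show ?thesis
        using *[of q p "n - Suc j"] False assms by (auto simp: Suc_diff_Suc split: if_splits)
    next
      case False
      then have "n = Suc j" using that by simp
      then show ?thesis
        using *[of q p 0] \<open>\<not> 1/2 \<le> p\<close> assms by (auto simp: Suc_diff_Suc split: if_splits)
    qed
    then show ?thesis
      using False by (intro that[of "\<lambda>j. 4^n - 4^(n - Suc j)"]) (auto intro: power_strict_increasing)
  qed
qed

text \<open>There are n gaps between n + 1 particles. A push at gap \<open>j\<close> moves its two
  particles apart by p + q = 1 in total, hence the unit coefficient of \<open>A j\<close>; the same
  displacements shrink the neighbouring gaps, hence the two subtracted terms.\<close>

definition reflected ::
  "real \<Rightarrow> real \<Rightarrow> nat \<Rightarrow> (nat \<Rightarrow> real \<Rightarrow> real) \<Rightarrow> (nat \<Rightarrow> real \<Rightarrow> real) \<Rightarrow> nat \<Rightarrow> real \<Rightarrow> real" where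
  "reflected p q n Y A j s = Y j s + A j s
     - (if Suc j < n then p * A (Suc j) s else 0) - (if 0 < j then q * A (j - 1) s else 0)"

text \<open>An approximate Skorokhod problem: \<open>A j\<close> may grow only while the \<open>j\<close>-th gap is at most \<open>e\<close>.\<close>
definition regulators ::
  "real \<Rightarrow> real \<Rightarrow> nat \<Rightarrow> real \<Rightarrow> real \<Rightarrow> (nat \<Rightarrow> real \<Rightarrow> real) \<Rightarrow> (nat \<Rightarrow> real \<Rightarrow> real) \<Rightarrow> bool" where
  "regulators p q n t e Y A \<longleftrightarrow> (\<forall>j<n.
     A j 0 = 0 \<and> continuous_on {0..t} (A j) \<and> mono_on {0..t} (A j) \<and>
     continuous_on {0..t} (reflected p q n Y A j) \<and>
     (\<forall>s\<in>{0..t}. 0 \<le> reflected p q n Y A j s) \<and>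
     (\<forall>s r. 0 \<le> s \<longrightarrow> s \<le> r \<longrightarrow> r \<le> t \<longrightarrow> (\<forall>v\<in>{s..r}. e < reflected p q n Y A j v) \<longrightarrow> A j r = A j s))"

lemma regulatorsD:
  assumes "regulators p q n t e Y A" "j < n"
  shows "A j 0 = 0" "continuous_on {0..t} (A j)" "mono_on {0..t} (A j)"
    "continuous_on {0..t} (reflected p q n Y A j)"
    "\<And>s. s \<in> {0..t} \<Longrightarrow> 0 \<le> reflected p q n Y A j s"
    "\<And>s r. \<lbrakk>0 \<le> s; s \<le> r; r \<le> t; \<And>v. v \<in> {s..r} \<Longrightarrow> e < reflected p q n Y A j v\<rbrakk> \<Longrightarrow> A j r = A j s"
  using assms unfolding regulators_def by blast+

text \<open>With its neighbours frozen, each gap is a one-dimensional Skorokhod problem, and the two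
  drives differ by at most the weighted neighbouring differences. Applying
  \<open>skorokhod_comparison\<close> in both directions bounds the supremum \<open>D i\<close> by
  \<open>e + N i\<close>; the weight \<open>u\<close> then closes the system.\<close>

lemma regulators_close:
  assumes pq: "0 \<le> p" "0 \<le> q" and t: "0 \<le> t" and e: "0 \<le> e"
    and A: "regulators p q n t e Y A" and L: "regulators p q n t 0 Y L"
    and u: "\<And>j. j < n \<Longrightarrow> 0 < u j"
      "\<And>j. j < n \<Longrightarrow> 1 + (if Suc j < n then p * u (Suc j) else 0)
                          + (if 0 < j then q * u (j - 1) else 0) \<le> u j"
    and j: "j < n" and s: "s \<in> {0..t}"
  shows "\<bar>A j s - L j s\<bar> \<le> e * u j"
proof -
  have "\<exists>r\<in>{0..t}. \<forall>s\<in>{0..t}. \<bar>A j s - L j s\<bar> \<le> \<bar>A j r - L j r\<bar>" if "j < n" for j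
    using regulatorsD(2)[OF A that] regulatorsD(2)[OF L that] t
    by (intro continuous_attains_sup) (auto intro!: continuous_on_rabs continuous_on_diff)
  then obtain r where r: "\<And>j. j < n \<Longrightarrow> r j \<in> {0..t}"
      "\<And>j s. j < n \<Longrightarrow> s \<in> {0..t} \<Longrightarrow> \<bar>A j s - L j s\<bar> \<le> \<bar>A j (r j) - L j (r j)\<bar>"
    by metis
  define D where "D j = \<bar>A j (r j) - L j (r j)\<bar>" for j
  have D: "\<bar>A j s - L j s\<bar> \<le> D j" if "j < n" "s \<in> {0..t}" for j s
    using r that by (simp add: D_def)
  define N where "N j = (if Suc j < n then p * D (Suc j) else 0) + (if 0 < j then q * D (j - 1) else 0)" for j
  have Dstep: "D i \<le> e + N i" if i: "i < n" for i
  proof -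
    define X where "X A s = reflected p q n Y A i s - A i s" for A :: "nat \<Rightarrow> real \<Rightarrow> real" and s
    have XA: "X A s + A i s = reflected p q n Y A i s" for A s by (simp add: X_def)
    have N0: "0 \<le> N i" using pq by (auto simp: N_def D_def)
    have XX: "\<bar>X A s - X L s\<bar> \<le> N i" if s: "s \<in> {0..t}" for s
    proof -
      have "X A s - X L s = - (if Suc i < n then p * (A (Suc i) s - L (Suc i) s) else 0)
              - (if 0 < i then q * (A (i-1) s - L (i-1) s) else 0)"
        by (auto simp: X_def reflected_def algebra_simps)
      moreover have "\<bar>p * (A (Suc i) s - L (Suc i) s)\<bar> \<le> p * D (Suc i)" if "Suc i < n"
        using D[OF that s] pq by (simp add: abs_mult mult_left_mono)
      moreover have "\<bar>q * (A (i-1) s - L (i-1) s)\<bar> \<le> q * D (i-1)" if "0 < i"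
        using D[of "i-1" s] s that i pq by (simp add: abs_mult mult_left_mono)
      ultimately show ?thesis unfolding N_def by (smt (verit))
    qed
    have ri: "r i \<in> {0..t}" using r i by auto
    have sub: "{0..r i} \<subseteq> {0..t}" using ri by auto
    have mon: "mono_on {0..r i} f" if "mono_on {0..t} f" for f :: "real \<Rightarrow> real"
      using mono_on_subset[OF that sub] .
    \<comment> \<open>Both comparisons end at \<open>r i\<close>, where the supremum
      \<open>D i\<close> is attained. \<open>A\<close> may grow at any gap up to \<open>e\<close>
      while \<open>L\<close> grows only at contact, so this direction costs \<open>e\<close> and the
      reverse one costs 0.\<close>
    have "A i (r i) \<le> L i (r i) + N i + e"
    proof (rule skorokhod_comparison[where X = "X A" and X' = "X L" and A = "A i" and A' = "L i"])
      show "continuous_on {0..r i} (\<lambda>s. X A s + A i s)" "continuous_on {0..r i} (A i)"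
        unfolding XA using regulatorsD(2,4)[OF A i] continuous_on_subset[OF _ sub] by metis+
      show "A i v = A i s" if "0 \<le> s" "s \<le> v" "v \<le> r i" "\<And>x. x \<in> {s..v} \<Longrightarrow> e < X A x + A i x" for s v
        using that ri unfolding XA by (intro regulatorsD(6)[OF A i]) auto
      show "X L s \<le> X A s + N i" if "s \<in> {0..r i}" for s
        using XX[of s] that ri by (simp add: abs_le_iff)
      show "0 \<le> X L s + L i s" if "s \<in> {0..r i}" for s
        using that sub unfolding XA by (intro regulatorsD(5)[OF L i]) auto
    qed (use ri e N0 regulatorsD(1)[OF A i] regulatorsD(1)[OF L i]
          mon[OF regulatorsD(3)[OF A i]] mon[OF regulatorsD(3)[OF L i]] in simp_all)
    moreover have "L i (r i) \<le> A i (r i) + N i + 0"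
    proof (rule skorokhod_comparison[where X = "X L" and X' = "X A" and A = "L i" and A' = "A i"])
      show "continuous_on {0..r i} (\<lambda>s. X L s + L i s)" "continuous_on {0..r i} (L i)"
        unfolding XA using regulatorsD(2,4)[OF L i] continuous_on_subset[OF _ sub] by metis+
      show "L i v = L i s" if "0 \<le> s" "s \<le> v" "v \<le> r i" "\<And>x. x \<in> {s..v} \<Longrightarrow> 0 < X L x + L i x" for s v
        using that ri unfolding XA by (intro regulatorsD(6)[OF L i]) auto
      show "X A s \<le> X L s + N i" if "s \<in> {0..r i}" for s
        using XX[of s] that ri by (simp add: abs_le_iff)
      show "0 \<le> X A s + A i s" if "s \<in> {0..r i}" for s
        using that sub unfolding XA by (intro regulatorsD(5)[OF A i]) auto
    qed (use ri e N0 regulatorsD(1)[OF A i] regulatorsD(1)[OF L i]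
          mon[OF regulatorsD(3)[OF A i]] mon[OF regulatorsD(3)[OF L i]] in simp_all)
    ultimately show ?thesis using e unfolding D_def by linarith
  qed
  have fin: "finite ((\<lambda>j. D j / u j) ` {..<n})" "(\<lambda>j. D j / u j) ` {..<n} \<noteq> {}" using j by auto
  obtain k where k: "k < n" and "D k / u k = Max ((\<lambda>j. D j / u j) ` {..<n})"
    using Max_in[OF fin] by (metis (no_types, lifting) imageE lessThan_iff)
  then have kmax: "D j / u j \<le> D k / u k" if "j < n" for j
    using Max_ge[OF fin(1)] that by simp
  define m where "m = D k / u k"
  have m: "D j \<le> m * u j" if "j < n" for j
    using kmax[OF that] u(1)[OF that] by (simp add: m_def divide_le_eq)
  have m0: "0 \<le> m" using u(1)[OF k] by (simp add: m_def D_def)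
  \<comment> \<open>\<open>k\<close> maximises \<open>D / u\<close>. The 1 of the supersolution
    inequality survives: since \<open>D k = m * u k\<close>, the bound
    \<open>D k \<le> e + N k\<close> leaves \<open>m \<le> e\<close>.\<close>
  have "N k \<le> m * (u k - 1)"
  proof -
    have "N k \<le> (if Suc k < n then p * (m * u (Suc k)) else 0) + (if 0 < k then q * (m * u (k - 1)) else 0)"
      unfolding N_def using m k pq by (intro add_mono) (auto intro!: mult_left_mono)
    also have "\<dots> = m * ((if Suc k < n then p * u (Suc k) else 0) + (if 0 < k then q * u (k - 1) else 0))"
      by (simp add: algebra_simps)
    also have "\<dots> \<le> m * (u k - 1)"
      using u(2)[OF k] m0 by (intro mult_left_mono) auto
    finally show ?thesis .
  qed
  moreover have "D k = m * u k" using u(1)[OF k] by (simp add: m_def)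
  ultimately have "m \<le> e" using Dstep[OF k] by (simp add: algebra_simps)
  then have "m * u j \<le> e * u j" using u(1)[OF j] by (simp add: mult_right_mono)
  then show ?thesis using D[OF j s] m[OF j] by linarith
qed

subsection \<open>Zero sets of rough paths with absolutely continuous drift\<close>

text \<open>The window K h is far below the typical size sqrt h of a Brownian increment. Natural
  \<open>T\<close>, \<open>K\<close> and the steps h = 1/(m+1) keep the conditions countable, so
  that they hold simultaneously almost surely; a liminf is what Fatou delivers, and it suffices for
  the contradiction later.\<close>

definition rough :: "(real \<Rightarrow> real) \<Rightarrow> bool" where
  "rough w \<longleftrightarrow> (\<forall>T K :: nat. liminf (\<lambda>m. emeasure lborel
     {s \<in> {0..real T}. \<bar>w (s + 1 / Suc m) - w s\<bar> \<le> real K * (1 / Suc m)}) = 0)"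

section \<open>Gaussian small balls and almost sure roughness\<close>

lemma normal_small_ball:
  assumes Z: "distributed M lborel Z (normal_density 0 \<sigma>)" and \<sigma>: "0 < \<sigma>" and a: "0 \<le> a"
  shows "emeasure M {\<omega> \<in> space M. \<bar>Z \<omega>\<bar> \<le> a} \<le> ennreal (a / \<sigma>)"
proof -
  \<comment> \<open>This follows from 4 < 2 pi. The factor 2 cancels against the length
    \<open>2 * a\<close> of the interval.\<close>
  have dens: "normal_density 0 \<sigma> z \<le> 1 / (2 * \<sigma>)" for z
  proof -
    have "2 * \<sigma> \<le> sqrt (2 * pi * \<sigma>\<^sup>2)"
      using \<sigma> pi_gt3 by (intro real_le_rsqrt) (simp add: power2_eq_square)
    then have "1 / sqrt (2 * pi * \<sigma>\<^sup>2) \<le> 1 / (2 * \<sigma>)"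
      using \<sigma> by (intro divide_left_mono) auto
    then have "1 / sqrt (2 * pi * \<sigma>\<^sup>2) * exp (-(z - 0)\<^sup>2 / (2 * \<sigma>\<^sup>2)) \<le> 1 / (2 * \<sigma>) * 1"
      using \<sigma> by (intro mult_mono) auto
    then show ?thesis unfolding normal_density_def by simp
  qed
  have "{\<omega> \<in> space M. \<bar>Z \<omega>\<bar> \<le> a} = Z -` {-a..a} \<inter> space M" by auto
  then have "emeasure M {\<omega> \<in> space M. \<bar>Z \<omega>\<bar> \<le> a}
      = (\<integral>\<^sup>+ z. ennreal (normal_density 0 \<sigma> z) * indicator {-a..a} z \<partial>lborel)"
    using distributed_emeasure[OF Z, of "{-a..a}"] by simp
  also have "\<dots> \<le> (\<integral>\<^sup>+ z. ennreal (1 / (2 * \<sigma>)) * indicator {-a..a} z \<partial>lborel)"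
    by (intro nn_integral_mono mult_right_mono ennreal_leI dens) auto
  also have "\<dots> = ennreal (a / \<sigma>)"
    using a \<sigma> by (subst nn_integral_cmult_indicator) (auto simp: ennreal_mult[symmetric])
  finally show ?thesis .
qed

text \<open>Joint measurability is what Fubini requires in \<open>AE_rough\<close>. Rounding time
  down to multiples of 1/(m+1) leaves countably many time values, which makes the rounded process
  jointly measurable; by path continuity it converges to \<open>W\<close>.\<close>

lemma measurable_continuous_process:
  fixes W :: "real \<Rightarrow> 'a \<Rightarrow> real"
  assumes meas: "\<And>t. W t \<in> borel_measurable M"
    and cont: "\<And>\<omega>. \<omega> \<in> space M \<Longrightarrow> continuous_on UNIV (\<lambda>t. W t \<omega>)"
  shows "(\<lambda>(t, \<omega>). W t \<omega>) \<in> borel_measurable (lborel \<Otimes>\<^sub>M M)"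
proof (rule borel_measurable_LIMSEQ_real)
  fix z :: "real \<times> 'a" assume "z \<in> space (lborel \<Otimes>\<^sub>M M)"
  then obtain t \<omega> where z: "z = (t, \<omega>)" "\<omega> \<in> space M" by (auto simp: space_pair_measure)
  have "(\<lambda>m. of_int \<lfloor>real (Suc m) * t\<rfloor> / real (Suc m)) \<longlonglongrightarrow> t"
  proof (rule tendsto_sandwich[of "\<lambda>m. t - 1 / real (Suc m)" _ _ "\<lambda>m. t"])
    show "(\<lambda>m. t - 1 / real (Suc m)) \<longlonglongrightarrow> t"
      using tendsto_diff[OF tendsto_const LIMSEQ_inverse_real_of_nat, of t] by (simp add: divide_inverse)
    have "real (Suc m) * t - 1 \<le> of_int \<lfloor>real (Suc m) * t\<rfloor>" for m by linarith
    then have "(real (Suc m) * t - 1) / real (Suc m) \<le> of_int \<lfloor>real (Suc m) * t\<rfloor> / real (Suc m)" for m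
      by (intro divide_right_mono) auto
    moreover have "(real (Suc m) * t - 1) / real (Suc m) = t - 1 / real (Suc m)" for m
      by (simp add: field_simps del: of_nat_Suc)
    ultimately show "\<forall>\<^sub>F m in sequentially. t - 1 / real (Suc m) \<le> of_int \<lfloor>real (Suc m) * t\<rfloor> / real (Suc m)"
      by simp
    have "of_int \<lfloor>real (Suc m) * t\<rfloor> \<le> t * real (Suc m)" for m by (simp add: mult.commute del: of_nat_Suc)
    then show "\<forall>\<^sub>F m in sequentially. of_int \<lfloor>real (Suc m) * t\<rfloor> / real (Suc m) \<le> t"
      by (simp add: divide_le_eq del: of_nat_Suc)
  qed auto
  moreover have "isCont (\<lambda>t. W t \<omega>) t"
    using cont[OF z(2)] by (simp add: continuous_on_eq_continuous_at)
  ultimately show "(\<lambda>m. (case z of (t, \<omega>) \<Rightarrow> W (of_int \<lfloor>real (Suc m) * t\<rfloor> / real (Suc m)) \<omega>))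
      \<longlonglongrightarrow> (case z of (t, \<omega>) \<Rightarrow> W t \<omega>)"
    unfolding z by (auto intro: isCont_tendsto_compose)
next
  fix m
  have [measurable]: "(\<lambda>z. \<lfloor>real (Suc m) * fst z\<rfloor>) \<in> measurable (lborel \<Otimes>\<^sub>M M) (count_space UNIV)"
    by measurable
  have [measurable]: "(\<lambda>z. W t (snd z)) \<in> borel_measurable (lborel \<Otimes>\<^sub>M M)" for t
    using meas by measurable
  have "(\<lambda>z. W (of_int \<lfloor>real (Suc m) * fst z\<rfloor> / real (Suc m)) (snd z)) \<in> borel_measurable (lborel \<Otimes>\<^sub>M M)"
    by (rule measurable_compose_countable[where f = "\<lambda>i z. W (of_int i / real (Suc m)) (snd z)"]) measurable
  then show "(\<lambda>(t, \<omega>). W (of_int \<lfloor>real (Suc m) * t\<rfloor> / real (Suc m)) \<omega>) \<in> borel_measurable (lborel \<Otimes>\<^sub>M M)"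
    by (simp add: case_prod_unfold)
qed

text \<open>The expected measures in the definition of roughness are at most \<open>T K \<surd>h\<close>; then Fatou.\<close>
lemma AE_rough:
  fixes W :: "real \<Rightarrow> 'a \<Rightarrow> real"
  assumes M: "prob_space M"
    and meas: "\<And>t. W t \<in> borel_measurable M"
    and cont: "\<And>\<omega>. \<omega> \<in> space M \<Longrightarrow> continuous_on UNIV (\<lambda>t. W t \<omega>)"
    and ball: "\<And>s h a. \<lbrakk>0 \<le> s; 0 < h; 0 \<le> a\<rbrakk> \<Longrightarrow>
      emeasure M {\<omega> \<in> space M. \<bar>W (s + h) \<omega> - W s \<omega>\<bar> \<le> a} \<le> ennreal (a / sqrt h)"
  shows "AE \<omega> in M. rough (\<lambda>s. W s \<omega>)"
proof -
  interpret prob_space M by fact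
  interpret pair_sigma_finite lborel M ..
  have W2: "(\<lambda>z. W (fst z) (snd z)) \<in> borel_measurable (lborel \<Otimes>\<^sub>M M)"
    using measurable_continuous_process[OF meas cont] by (simp add: case_prod_unfold)
  have [measurable]: "(\<lambda>z. W (f z) (g z)) \<in> borel_measurable N"
    if "f \<in> borel_measurable N" "g \<in> measurable N M" for f g N
  proof -
    have "(\<lambda>z. (f z, g z)) \<in> measurable N (lborel \<Otimes>\<^sub>M M)" using that by measurable
    from measurable_compose[OF this W2] show ?thesis by simp
  qed
  have "AE \<omega> in M. liminf (\<lambda>m. emeasure lborel
     {s \<in> {0..real T}. \<bar>W (s + 1 / Suc m) \<omega> - W s \<omega>\<bar> \<le> real K * (1 / Suc m)}) = 0" for T K :: nat
  proof -
    define S where "S m \<omega> = {s \<in> {0..real T}. \<bar>W (s + 1 / Suc m) \<omega> - W s \<omega>\<bar> \<le> real K * (1 / Suc m)}" for m \<omega>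
    define f where "f m s \<omega> = (indicator (S m \<omega>) s :: ennreal)" for m s \<omega>
    have f_meas: "(\<lambda>z. f m (fst z) (snd z)) \<in> borel_measurable (lborel \<Otimes>\<^sub>M M)" for m
    proof -
      have "(\<lambda>z. f m (fst z) (snd z)) = indicator {z. fst z \<in> {0..real T} \<and>
          \<bar>W (fst z + 1 / Suc m) (snd z) - W (fst z) (snd z)\<bar> \<le> real K * (1 / Suc m)}"
        by (auto simp: f_def S_def indicator_def)
      also have "\<dots> \<in> borel_measurable (lborel \<Otimes>\<^sub>M M)" by measurable
      finally show ?thesis .
    qed
    have f_meas': "case_prod (f m) \<in> borel_measurable (lborel \<Otimes>\<^sub>M M)" for m
      using f_meas[of m] by (simp add: case_prod_unfold)
    have S_meas: "S m \<omega> \<in> sets lborel" if "\<omega> \<in> space M" for m \<omega>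
    proof -
      have "(\<lambda>s. W s \<omega>) \<in> borel_measurable borel" using cont[OF that] by (rule borel_measurable_continuous_onI)
      then show ?thesis unfolding S_def by measurable
    qed
    have eq: "emeasure lborel (S m \<omega>) = (\<integral>\<^sup>+ s. f m s \<omega> \<partial>lborel)" if "\<omega> \<in> space M" for m \<omega>
      unfolding f_def using S_meas[OF that] by simp
    \<comment> \<open>At a fixed time, the window K h over the scale sqrt h leaves K sqrt h, with h
      = 1/(m+1). Fubini then turns this into a bound on the expected measure of
      \<open>S m \<omega>\<close>.\<close>
    have inner: "(\<integral>\<^sup>+ \<omega>. f m s \<omega> \<partial>M) \<le> ennreal (real K * sqrt (1 / Suc m)) * indicator {0..real T} s" for m s
    proof (cases "s \<in> {0..real T}")
      have r: "1 / real (Suc m) / sqrt (1 / real (Suc m)) = sqrt (1 / real (Suc m))"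
        by (rule real_div_sqrt) simp
      case True
      have "(\<integral>\<^sup>+ \<omega>. f m s \<omega> \<partial>M) = (\<integral>\<^sup>+ \<omega>. indicator {\<omega> \<in> space M. \<bar>W (s + 1 / Suc m) \<omega> - W s \<omega>\<bar> \<le> real K * (1 / Suc m)} \<omega> \<partial>M)"
        using True by (intro nn_integral_cong) (auto simp: f_def S_def indicator_def)
      also have "\<dots> = emeasure M {\<omega> \<in> space M. \<bar>W (s + 1 / Suc m) \<omega> - W s \<omega>\<bar> \<le> real K * (1 / Suc m)}"
        by (intro nn_integral_indicator) measurable
      also have "\<dots> \<le> ennreal (real K * (1 / Suc m) / sqrt (1 / Suc m))"
        using True by (intro ball) auto
      also have "real K * (1 / Suc m) / sqrt (1 / Suc m) = real K * sqrt (1 / Suc m)"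
        by (subst times_divide_eq_right[symmetric]) (simp only: r)
      finally show ?thesis using True by simp
    next
      case False
      then have "f m s \<omega> = 0" for \<omega> by (auto simp: f_def S_def)
      then show ?thesis by simp
    qed
    have bound: "(\<integral>\<^sup>+ \<omega>. emeasure lborel (S m \<omega>) \<partial>M) \<le> ennreal (real K * sqrt (1 / Suc m) * real T)" for m
    proof -
      have "(\<integral>\<^sup>+ \<omega>. emeasure lborel (S m \<omega>) \<partial>M) = (\<integral>\<^sup>+ \<omega>. (\<integral>\<^sup>+ s. f m s \<omega> \<partial>lborel) \<partial>M)"
        by (intro nn_integral_cong eq)
      also have "\<dots> = (\<integral>\<^sup>+ s. (\<integral>\<^sup>+ \<omega>. f m s \<omega> \<partial>M) \<partial>lborel)"
        by (rule Fubini'[OF f_meas'])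
      also have "\<dots> \<le> (\<integral>\<^sup>+ s. ennreal (real K * sqrt (1 / Suc m)) * indicator {0..real T} s \<partial>lborel)"
        by (intro nn_integral_mono inner)
      also have "\<dots> = ennreal (real K * sqrt (1 / Suc m) * real T)"
        by (subst nn_integral_cmult_indicator) (auto simp: ennreal_mult)
      finally show ?thesis .
    qed
    have S_fun_meas[measurable]: "(\<lambda>\<omega>. emeasure lborel (S m \<omega>)) \<in> borel_measurable M" for m
    proof -
      have "(\<lambda>\<omega>. \<integral>\<^sup>+ s. f m s \<omega> \<partial>lborel) \<in> borel_measurable M"
        using measurable_compose[OF measurable_pair_swap' f_meas[of m]]
        by (intro lborel.borel_measurable_nn_integral) (simp add: case_prod_unfold)
      then show ?thesis by (subst measurable_cong[OF eq]) auto
    qed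
    have "(\<lambda>m. ennreal (real K * sqrt (1 / Suc m) * real T)) \<longlonglongrightarrow> ennreal (real K * sqrt 0 * real T)"
      by (intro tendsto_ennrealI tendsto_intros) (use LIMSEQ_inverse_real_of_nat in \<open>simp add: divide_inverse\<close>)
    then have "liminf (\<lambda>m. ennreal (real K * sqrt (1 / Suc m) * real T)) = 0"
      by (simp add: lim_imp_Liminf)
    moreover have "(\<integral>\<^sup>+ \<omega>. liminf (\<lambda>m. emeasure lborel (S m \<omega>)) \<partial>M) \<le> liminf (\<lambda>m. \<integral>\<^sup>+ \<omega>. emeasure lborel (S m \<omega>) \<partial>M)"
      by (intro nn_integral_liminf) measurable
    moreover have "\<dots> \<le> liminf (\<lambda>m. ennreal (real K * sqrt (1 / Suc m) * real T))"
      by (intro Liminf_mono always_eventually allI bound)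
    ultimately have "(\<integral>\<^sup>+ \<omega>. liminf (\<lambda>m. emeasure lborel (S m \<omega>)) \<partial>M) = 0"
      by simp
    then show ?thesis
      by (subst (asm) nn_integral_0_iff_AE) (auto simp: S_def)
  qed
  then show ?thesis unfolding rough_def by (simp add: AE_all_countable)
qed

section \<open>Zero sets of a rough path plus an indefinite integral\<close>

lemma continuous_on_indefinite_integral:
  fixes f :: "real \<Rightarrow> real"
  assumes f: "\<And>t. 0 \<le> t \<Longrightarrow> f integrable_on {0..t}"
  shows "continuous_on UNIV (\<lambda>s. integral {0..max 0 s} f)"
proof -
  have "continuous_on {..<b} (\<lambda>s. integral {0..max 0 s} f)" if "0 < b" for b
    using that
    by (intro continuous_on_compose2[OF indefinite_integral_continuous_1[OF f[of b]]] continuous_intros) auto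
  then have "isCont (\<lambda>s. integral {0..max 0 s} f) s" for s
    by (rule continuous_on_interior[of "{..<\<bar>s\<bar> + 1}"]) (auto simp: interior_open)
  then show ?thesis by (simp add: continuous_on_eq_continuous_at)
qed

lemma fmeasurable_Icc: "{a..b :: real} \<in> fmeasurable lborel"
  unfolding box_real(2)[symmetric] by (rule fmeasurable_cbox)

text \<open>The zero set \<open>E\<close> meets its translate by a small \<open>h\<close> in almost all of its measure, and on the
  intersection the increment of \<open>w\<close> over \<open>h\<close> is minus that of \<open>\<integral>f\<close>, which outside a set of small
  measure is at most \<open>K h\<close>.\<close>
lemma rough_zero_set_null:
  assumes w: "rough w" "continuous_on UNIV w" and t: "0 \<le> t"
    and f: "\<And>t. 0 \<le> t \<Longrightarrow> f integrable_on {0..t}" "\<And>t. 0 \<le> t \<Longrightarrow> (\<lambda>s. \<bar>f s\<bar>) integrable_on {0..t}"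
    and G: "\<And>s. s \<in> {0..t} \<Longrightarrow> G s = c + w s + integral {0..s} f"
  shows "{s \<in> {0..t}. G s = (0::real)} \<in> null_sets lborel"
proof -
  define E where "E = {s \<in> {0..t}. G s = 0}"
  define T where "T = nat \<lceil>t\<rceil>"
  have T: "t \<le> real T" using t by (simp add: T_def)
  \<comment> \<open>Increments of \<open>g\<close> dominate those of the drift integral. With
    \<open>max 0 s\<close> it is continuous and monotone on the whole line.\<close>
  define g where "g s = integral {0..max 0 s} (\<lambda>s. \<bar>f s\<bar>)" for s
  have g_cont: "continuous_on S g" for S
    unfolding g_def using continuous_on_indefinite_integral[OF f(2)] continuous_on_subset by blast
  have g_mono: "g s \<le> g r" if "s \<le> r" for s r
    unfolding g_def using that by (intro integral_subset_le f) auto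
  have g0: "0 \<le> g s" for s unfolding g_def by (intro integral_nonneg f) auto
  have F_incr: "\<bar>integral {0..r} f - integral {0..s} f\<bar> \<le> g r - g s" if "0 \<le> s" "s \<le> r" for s r
  proof -
    have sub: "f integrable_on {s..r}" "(\<lambda>s. \<bar>f s\<bar>) integrable_on {s..r}"
      using f[of r] that by (auto intro: integrable_on_subinterval)
    have "\<bar>integral {s..r} f\<bar> \<le> integral {s..r} (\<lambda>s. \<bar>f s\<bar>)"
      using integral_norm_bound_integral[of f "{s..r}" "\<lambda>s. \<bar>f s\<bar>"] sub by simp
    moreover have "integral {0..s} f + integral {s..r} f = integral {0..r} f"
      using that f by (intro Henstock_Kurzweil_Integration.integral_combine) auto
    moreover have "integral {0..s} (\<lambda>s. \<bar>f s\<bar>) + integral {s..r} (\<lambda>s. \<bar>f s\<bar>) = integral {0..r} (\<lambda>s. \<bar>f s\<bar>)"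
      using that f by (intro Henstock_Kurzweil_Integration.integral_combine) auto
    ultimately show ?thesis using that by (simp add: g_def max_def)
  qed
  have "continuous_on {0..t} (\<lambda>s. integral {0..s} f)"
    using f t by (intro indefinite_integral_continuous_1) auto
  then have "continuous_on {0..t} (\<lambda>s. c + w s + integral {0..s} f)"
    using w(2) by (intro continuous_intros) (auto intro: continuous_on_subset)
  then have contG: "continuous_on {0..t} G"
    by (rule continuous_on_eq) (simp add: G)
  have "closed E"
    using continuous_closed_preimage[OF contG, of "{0}"] by (simp add: vimage_def Int_def E_def)
  moreover have "bounded E"
    by (rule bounded_subset[OF bounded_closed_interval[of 0 t]]) (auto simp: E_def)
  ultimately have cE: "compact E"
    by (simp add: compact_eq_bounded_closed)
  have E_meas: "E \<in> fmeasurable lborel"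
    using cE emeasure_compact_finite by (intro fmeasurableI) (auto intro: borel_compact)
  define \<mu> where "\<mu> = measure lborel E"
  have "\<mu> = 0"
  proof (rule ccontr)
    assume "\<mu> \<noteq> 0"
    then have \<mu>: "0 < \<mu>" by (simp add: \<mu>_def zero_less_measure_iff)
    \<comment> \<open>By compactness of \<open>E\<close>, its translates by less than some
      \<open>d\<close> stay inside \<open>U\<close>, whose excess over \<open>E\<close> is at most
      \<open>\<mu> / 4\<close>.\<close>
    obtain U where U: "open U" "E \<subseteq> U" "emeasure lborel (U - E) < ennreal (\<mu> / 4)"
      using outer_regular_lborel[of E "\<mu> / 4"] E_meas \<mu> by (auto simp: fmeasurable_def)
    have UE: "U - E \<in> fmeasurable lborel" "measure lborel (U - E) \<le> \<mu> / 4"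
    proof -
      show "U - E \<in> fmeasurable lborel"
        using U E_meas by (intro fmeasurableI) (auto simp: fmeasurable_def less_top[symmetric])
      then show "measure lborel (U - E) \<le> \<mu> / 4"
        using U(3) \<mu> by (simp add: emeasure_eq_measure2 ennreal_less_iff)
    qed
    have U_eq: "U = E \<union> (U - E)" using U by auto
    have U_meas: "U \<in> fmeasurable lborel" using U_eq UE E_meas fmeasurable.Un by metis
    have \<mu>U: "measure lborel U \<le> \<mu> + \<mu> / 4"
      using measure_Un_le[of E lborel "U - E"] UE E_meas U_eq by (auto simp: \<mu>_def fmeasurable_def)
    obtain d where d: "0 < d" "(\<Union>x\<in>E. ball x d) \<subseteq> U"
      using compact_subset_open_imp_ball_epsilon_subset[OF cE U(1,2)] .
    \<comment> \<open>Markov's inequality: the integral of \<open>g (s + h) - g s\<close> over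
      \<open>{0..real T}\<close> is at most \<open>h * g (real T + 1)\<close> for h <= 1, so this
      \<open>K\<close> gives the exceptional set \<open>N\<close> measure at most
      \<open>\<mu> / 4\<close>. The added 1 keeps \<open>K\<close> positive.\<close>
    define K where "K = nat \<lceil>4 * g (real T + 1) / \<mu>\<rceil> + 1"
    have K: "g (real T + 1) \<le> real K * (\<mu> / 4)" "0 < K"
    proof -
      have "4 * g (real T + 1) / \<mu> \<le> real K" unfolding K_def by linarith
      then show "g (real T + 1) \<le> real K * (\<mu> / 4)" using \<mu> by (simp add: field_simps)
    qed (simp add: K_def)
    define X where "X h = {s \<in> {0..real T}. \<bar>w (s + h) - w s\<bar> \<le> real K * h}" for h
    have X_meas: "X h \<in> fmeasurable lborel" for h
    proof (rule fmeasurableI2)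
      show "{0..real T} \<in> fmeasurable lborel" by (rule fmeasurable_Icc)
      have "w \<in> borel_measurable borel" using w(2) by (rule borel_measurable_continuous_onI)
      then show "X h \<in> sets lborel" unfolding X_def by measurable
    qed (auto simp: X_def)
    have X: "\<mu> / 2 \<le> measure lborel (X h)" if h: "0 < h" "h < d" "h \<le> 1" for h
    proof -
      define E' where "E' = (+) h -` E"
      have "emeasure lborel E = emeasure (distr lborel borel ((+) h)) E" by (simp add: lborel_distr_plus)
      also have "\<dots> = emeasure lborel E'"
        using E_meas by (subst emeasure_distr) (auto simp: E'_def fmeasurable_def)
      finally have E'_em: "emeasure lborel E' = emeasure lborel E" by simp
      have "E' \<in> sets borel"
        unfolding E'_def using E_meas by (intro measurable_sets_borel[of _ borel]) (auto simp: fmeasurable_def)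
      then have E'_meas: "E' \<in> fmeasurable lborel"
        using E'_em E_meas by (simp add: fmeasurable_def)
      have E'_\<mu>: "measure lborel E' = \<mu>" using E'_em by (simp add: measure_def \<mu>_def)
      have "E' \<subseteq> U"
      proof
        fix s assume "s \<in> E'"
        then have "s \<in> ball (h + s) d" "h + s \<in> E" using h by (auto simp: E'_def dist_real_def)
        then show "s \<in> U" using d(2) by blast
      qed
      then have "measure lborel (E \<union> E') \<le> measure lborel U"
        using U U_meas E_meas E'_meas by (intro measure_mono_fmeasurable) (auto simp: fmeasurable_def)
      \<comment> \<open>Inclusion-exclusion: twice \<mu> minus at most 5/4 of \<mu>. Removing
        \<open>N\<close> still leaves half of \<mu> for \<open>X h\<close>, for every small h, which
        contradicts roughness.\<close>
      then have EE': "\<mu> - \<mu> / 4 \<le> measure lborel (E \<inter> E')"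
        using measure_Un3[OF E_meas E'_meas] E'_\<mu> \<mu>U by (simp add: \<mu>_def)
      define N where "N = {s \<in> {0..real T}. real K * h < g (s + h) - g s}"
      have "g \<in> borel_measurable borel" using g_cont by (rule borel_measurable_continuous_onI)
      then have N_sets: "N \<in> sets borel" unfolding N_def by measurable
      have N_meas: "N \<in> fmeasurable lborel"
        by (rule fmeasurableI2[OF fmeasurable_Icc[of 0 "real T"]]) (use N_sets in \<open>auto simp: N_def\<close>)
      have "real K * h * measure lborel N \<le> integral {0..real T} (\<lambda>s. g (s + h) - g s)"
      proof (rule has_integral_le)
        have "((\<lambda>s. real K * h * 1) has_integral real K * h * measure lborel N) N"
          using N_sets N_meas by (intro has_integral_mult_right has_integral_measure_lborel) (auto simp: fmeasurable_def)
        then have "((\<lambda>s. real K * h) has_integral real K * h * measure lborel N) N" by simp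
        moreover have "N \<subseteq> {0..real T}" by (auto simp: N_def)
        ultimately show "((\<lambda>s. if s \<in> N then real K * h else 0) has_integral real K * h * measure lborel N) {0..real T}"
          by (subst has_integral_restrict)
        show "((\<lambda>s. g (s + h) - g s) has_integral integral {0..real T} (\<lambda>s. g (s + h) - g s)) {0..real T}"
          by (intro integrable_integral integrable_continuous_interval continuous_intros
                continuous_on_compose2[OF g_cont[of UNIV]] g_cont) auto
        show "(if s \<in> N then real K * h else 0) \<le> g (s + h) - g s" if "s \<in> {0..real T}" for s
          using g_mono[of s "s + h"] h by (auto simp: N_def)
      qed
      \<comment> \<open>The integral telescopes to a window of length h after T minus one after 0;
        the latter is nonnegative and is dropped.\<close>
      also have "\<dots> = integral {0..real T} (\<lambda>s. g (s + h)) - integral {0..real T} g"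
        by (intro integral_diff integrable_continuous_interval continuous_intros
              continuous_on_compose2[OF g_cont[of UNIV]] g_cont) auto
      also have "integral {0..real T} (\<lambda>s. g (s + h)) = integral {h..real T + h} g"
        using integral_shift_real_ivl[of h h "real T + h" g] by simp
      also have "integral {h..real T + h} g - integral {0..real T} g
          = integral {real T..real T + h} g - integral {0..h} g"
      proof -
        have "integral {0..a} g + integral {a..real T + h} g = integral {0..real T + h} g"
          if "0 \<le> a" "a \<le> real T + h" for a
          using that g_cont by (intro Henstock_Kurzweil_Integration.integral_combine integrable_continuous_interval) auto
        from this[of h] this[of "real T"] show ?thesis using h by simp
      qed
      also have "\<dots> \<le> integral {real T..real T + h} g"
        using integral_nonneg[OF integrable_continuous_interval[OF g_cont[of "{0..h}"]]] g0 by simp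
      also have "\<dots> \<le> integral {real T..real T + h} (\<lambda>s. g (real T + 1))"
        using h by (intro integral_le integrable_continuous_interval g_cont g_mono) auto
      also have "\<dots> = h * g (real T + 1)" using h by simp
      also have "\<dots> \<le> h * (real K * (\<mu> / 4))" using h K by (intro mult_left_mono) auto
      finally have "real K * h * measure lborel N \<le> real K * h * (\<mu> / 4)" by (simp add: mult_ac)
      then have N: "measure lborel N \<le> \<mu> / 4" using h K by (simp add: mult_le_cancel_left_pos)
      have "E \<inter> E' \<subseteq> X h \<union> N"
      proof
        fix s assume s: "s \<in> E \<inter> E'"
        then have st: "s \<in> {0..t}" "s + h \<in> {0..t}" "G s = 0" "G (s + h) = 0"
          by (auto simp: E_def E'_def add.commute)
        then have "w (s + h) - w s = - (integral {0..s + h} f - integral {0..s} f)"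
          using G[of s] G[of "s + h"] by simp
        then have "\<bar>w (s + h) - w s\<bar> \<le> g (s + h) - g s"
          using F_incr[of s "s + h"] st h by simp
        then show "s \<in> X h \<union> N" using st T by (auto simp: X_def N_def)
      qed
      then have "measure lborel (E \<inter> E') \<le> measure lborel (X h \<union> N)"
        using X_meas[of h] N_meas E_meas E'_meas by (intro measure_mono_fmeasurable fmeasurable.Un) (auto simp: fmeasurable_def)
      also have "\<dots> \<le> measure lborel (X h) + measure lborel N"
        using X_meas[of h] N_meas by (intro measure_Un_le) (auto simp: fmeasurable_def)
      finally show ?thesis using EE' N by simp
    qed
    have "ennreal (\<mu> / 2) \<le> liminf (\<lambda>m. emeasure lborel (X (1 / real (Suc m))))"
    proof (rule Liminf_bounded)
      have "\<forall>\<^sub>F m in sequentially. 1 / real (Suc m) < d"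
        using LIMSEQ_inverse_real_of_nat d(1) by (auto simp: divide_inverse dest: order_tendstoD(2))
      then show "\<forall>\<^sub>F m in sequentially. ennreal (\<mu> / 2) \<le> emeasure lborel (X (1 / real (Suc m)))"
        by eventually_elim (use X X_meas in \<open>auto simp: emeasure_eq_measure2 intro!: ennreal_leI simp del: of_nat_Suc\<close>)
    qed
    also have "\<dots> = 0" using w(1) unfolding rough_def X_def by blast
    finally show False using \<mu> by (simp add: ennreal_eq_0_iff)
  qed
  then have "emeasure lborel E = 0" using E_meas by (simp add: \<mu>_def emeasure_eq_measure2)
  then show ?thesis using E_meas unfolding E_def by (auto simp: null_sets_def fmeasurable_def)
qed

subsection \<open>Regulators of the two particle systems\<close>

lemma continuous_on_max0:
  fixes f :: "real \<Rightarrow> real"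
  assumes "continuous_on {0..} f"
  shows "continuous_on UNIV (\<lambda>s. f (max 0 s))"
  by (rule continuous_on_compose2[OF assms]) (auto intro!: continuous_intros)

text \<open>The occupied sets grow with time, which gives monotonicity. A path positive on a compact
  interval stays above a positive level there, and below that level the occupied sets at both
  endpoints coincide. Continuity of \<open>L\<close> is obtained in
  \<open>local_time_regulators\<close> from the equation for the particles.\<close>

lemma local_time_props:
  assumes Z: "continuous_on {0..} Z" and L: "\<And>t. 0 \<le> t \<Longrightarrow> is_right_local_time_0 Z t (L t)"
  shows "L 0 = 0" and "mono_on {0..} L"
    and "\<And>s r. \<lbrakk>0 \<le> s; s \<le> r; \<And>v. v \<in> {s..r} \<Longrightarrow> 0 < Z v\<rbrakk> \<Longrightarrow> L r = L s"
proof -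
  define occ where "occ t e = measure lborel {s \<in> {0..t}. 0 \<le> Z s \<and> Z s < e} / e" for t e
  have lim: "((\<lambda>e. occ t e) \<longlongrightarrow> L t) (at_right 0)" if "0 \<le> t" for t
    using L[OF that] by (simp add: is_right_local_time_0_def occ_def)
  have "occ 0 e = 0" for e
  proof -
    consider "{s \<in> {0..0}. 0 \<le> Z s \<and> Z s < e} = {}" | "{s \<in> {0..0}. 0 \<le> Z s \<and> Z s < e} = {0}"
      by auto
    then have "measure lborel {s \<in> {0..0}. 0 \<le> Z s \<and> Z s < e} = 0"
      by cases (simp_all only: measure_empty measure_lborel_singleton)
    then show ?thesis by (simp add: occ_def)
  qed
  then show "L 0 = 0" using lim[of 0] by (simp add: tendsto_const_iff)
  have cont: "continuous_on UNIV (\<lambda>s. Z (max 0 s))"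
    by (rule continuous_on_max0[OF Z])
  have fin: "{s \<in> {0..t}. 0 \<le> Z s \<and> Z s < e} \<in> fmeasurable lborel" for t e
  proof (rule fmeasurableI2)
    show "{0..t} \<in> fmeasurable lborel" by (rule fmeasurable_Icc)
    have "(\<lambda>s. Z (max 0 s)) \<in> borel_measurable borel"
      using cont by (rule borel_measurable_continuous_onI)
    then have "{s \<in> {0..t}. 0 \<le> Z (max 0 s) \<and> Z (max 0 s) < e} \<in> sets lborel" by measurable
    also have "{s \<in> {0..t}. 0 \<le> Z (max 0 s) \<and> Z (max 0 s) < e} = {s \<in> {0..t}. 0 \<le> Z s \<and> Z s < e}"
      by (auto simp: max_def)
    finally show "{s \<in> {0..t}. 0 \<le> Z s \<and> Z s < e} \<in> sets lborel" .
  qed auto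
  show "mono_on {0..} L"
  proof (rule mono_onI)
    fix s r :: real assume sr: "s \<in> {0..}" "r \<in> {0..}" "s \<le> r"
    show "L s \<le> L r"
    proof (rule tendsto_le[OF _ lim[of r] lim[of s]])
      have "occ s e \<le> occ r e" if "0 < e" for e
        unfolding occ_def
        by (intro divide_right_mono measure_mono_fmeasurable fin fmeasurableD[OF fin]) (use that sr in auto)
      then show "\<forall>\<^sub>F e in at_right 0. occ s e \<le> occ r e"
        by (rule eventually_mono[OF eventually_at_right_less])
    qed (use sr in auto)
  qed
  show "L r = L s" if sr: "0 \<le> s" "s \<le> r" and pos: "\<And>v. v \<in> {s..r} \<Longrightarrow> 0 < Z v" for s r
  proof -
    have "\<exists>v\<in>{s..r}. \<forall>u\<in>{s..r}. Z v \<le> Z u"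
      using sr by (intro continuous_attains_inf continuous_on_subset[OF Z]) auto
    then obtain v where v: "v \<in> {s..r}" "\<And>u. u \<in> {s..r} \<Longrightarrow> Z v \<le> Z u" by blast
    have "occ r e = occ s e" if "e \<le> Z v" for e
    proof -
      have "Z u < e \<Longrightarrow> u \<le> s" if "u \<le> r" for u
        using v(2)[of u] \<open>e \<le> Z v\<close> that by (cases "u \<le> s") auto
      then have "{u \<in> {0..r}. 0 \<le> Z u \<and> Z u < e} = {u \<in> {0..s}. 0 \<le> Z u \<and> Z u < e}"
        using sr by auto
      then show ?thesis by (simp add: occ_def)
    qed
    moreover have "\<forall>\<^sub>F e in at_right 0. e < Z v"
      using pos[OF v(1)] eventually_at_right_real[of 0 "Z v"] by (auto elim: eventually_mono)
    ultimately have "\<forall>\<^sub>F e in at_right 0. occ r e = occ s e" by (auto elim!: eventually_mono)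
    then have "((\<lambda>e. occ s e) \<longlongrightarrow> L r) (at_right 0)"
      using lim[of r] sr by (auto intro: Lim_transform_eventually)
    then show ?thesis using tendsto_unique[OF _ _ lim[of s]] sr by auto
  qed
qed

section \<open>Both particle systems in a common form\<close>

definition gap_drive :: "(nat \<Rightarrow> real) \<Rightarrow> (nat \<Rightarrow> real \<Rightarrow> real) \<Rightarrow> nat \<Rightarrow> real \<Rightarrow> real" where
  "gap_drive y0 \<beta> j s = y0 (Suc j) - y0 j + (\<beta> (Suc j) s - \<beta> j s)"

text \<open>Form shared by the two systems: \<open>A\<close> is the family of local times for y, and
  minus the time integral of V_eps' at the gap for x^eps.\<close>

definition pushed ::
  "real \<Rightarrow> real \<Rightarrow> nat \<Rightarrow> (nat \<Rightarrow> real) \<Rightarrow> (nat \<Rightarrow> real \<Rightarrow> real) \<Rightarrow> (nat \<Rightarrow> real \<Rightarrow> real) \<Rightarrow> nat \<Rightarrow> real \<Rightarrow> real" where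
  "pushed p q n y0 \<beta> A j s = y0 j + \<beta> j s
     - (if j < n then p * A j s else 0) + (if 0 < j then q * A (j - 1) s else 0)"

lemma pushed_gap:
  assumes "p + q = 1" "j < n"
  shows "pushed p q n y0 \<beta> A (Suc j) s - pushed p q n y0 \<beta> A j s
    = reflected p q n (gap_drive y0 \<beta>) A j s"
proof -
  have "p * A j s + q * A j s = A j s" using assms(1) by (simp flip: distrib_right)
  then show ?thesis
    using assms(2) by (simp add: pushed_def reflected_def gap_drive_def algebra_simps)
qed

text \<open>The equation of particle \<open>j\<close> gives access only to the combination of gaps
  \<open>j\<close> and \<open>j - 1\<close> with coefficients \<open>p\<close> and \<open>q\<close>.
  If \<open>p\<close> is nonzero, it can be solved for gap \<open>j\<close> successively from the
  left end; if p = 0, particle \<open>Suc j\<close> sees gap \<open>j\<close> alone. This transfers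
  continuity or integrability to single gaps.\<close>

lemma chain_induct_either_end:
  fixes p q :: real and j n :: nat
  assumes pq: "p + q = 1"
    and left: "\<And>j. \<lbrakk>p \<noteq> 0; j < n; 0 < j \<Longrightarrow> P (j - 1)\<rbrakk> \<Longrightarrow> P j"
    and right: "\<And>j. \<lbrakk>p = 0; q = 1; j < n\<rbrakk> \<Longrightarrow> P j"
    and j: "j < n"
  shows "P j"
proof (cases "p = 0")
  case True
  then show ?thesis using right pq j by simp
next
  case False
  from j show ?thesis
  proof (induction j)
    case 0
    show ?case by (rule left[OF False]) (use 0 in simp_all)
  next
    case (Suc j)
    show ?case by (rule left[OF False]) (use Suc in simp_all)
  qed
qed

lemma local_time_regulators:
  assumes pq: "p + q = 1" and t: "0 \<le> t"
    and \<beta>: "\<And>j. j \<le> n \<Longrightarrow> continuous_on {0..} (\<beta> j)"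
    and ys: "\<And>j. j \<le> n \<Longrightarrow> continuous_on {0..} (ys j)"
    and ordered: "\<And>j s. \<lbrakk>j < n; 0 \<le> s\<rbrakk> \<Longrightarrow> ys j s \<le> ys (Suc j) s"
    and L: "\<And>j s. \<lbrakk>j < n; 0 \<le> s\<rbrakk> \<Longrightarrow> is_right_local_time_0 (\<lambda>s. ys (Suc j) s - ys j s) s (L j s)"
    and eq: "\<And>j s. \<lbrakk>j \<le> n; 0 \<le> s\<rbrakk> \<Longrightarrow> ys j s = pushed p q n y0 \<beta> L j s"
  shows "regulators p q n t 0 (gap_drive y0 \<beta>) L"
  unfolding regulators_def
proof (intro allI impI)
  fix j assume j: "j < n"
  let ?Z = "\<lambda>s. ys (Suc j) s - ys j s"
  have Z_cont: "continuous_on {0..} ?Z" using ys j by (intro continuous_intros) auto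
  have R: "reflected p q n (gap_drive y0 \<beta>) L j s = ?Z s" if "0 \<le> s" for s
    using pushed_gap[OF pq j, of y0 \<beta> L s] eq[of j s] eq[of "Suc j" s] j that by simp
  have L_cont: "continuous_on {0..} (L j)"
  proof (rule chain_induct_either_end[OF pq, where P = "\<lambda>j. continuous_on {0..} (L j)", OF _ _ j])
    fix j assume p: "p \<noteq> 0" and j: "j < n" and IH: "0 < j \<Longrightarrow> continuous_on {0..} (L (j - 1))"
    have "continuous_on {0..} (\<lambda>s. (y0 j + \<beta> j s + (if 0 < j then q * L (j - 1) s else 0) - ys j s) / p)"
      using IH \<beta>[of j] ys[of j] j p by (cases "0 < j") (auto intro!: continuous_intros)
    then show "continuous_on {0..} (L j)"
      by (rule continuous_on_eq) (use eq[of j] j p in \<open>auto simp: pushed_def\<close>)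
  next
    fix j assume p: "p = 0" "q = 1" and j: "j < n"
    have "continuous_on {0..} (\<lambda>s. ys (Suc j) s - y0 (Suc j) - \<beta> (Suc j) s)"
      using \<beta>[of "Suc j"] ys[of "Suc j"] j by (intro continuous_intros) auto
    then show "continuous_on {0..} (L j)"
      by (rule continuous_on_eq) (use eq[of "Suc j"] j p in \<open>auto simp: pushed_def\<close>)
  qed
  note LT = local_time_props[of ?Z "L j", OF Z_cont L[OF j]]
  show "L j 0 = 0 \<and> continuous_on {0..t} (L j) \<and> mono_on {0..t} (L j) \<and>
     continuous_on {0..t} (reflected p q n (gap_drive y0 \<beta>) L j) \<and>
     (\<forall>s\<in>{0..t}. 0 \<le> reflected p q n (gap_drive y0 \<beta>) L j s) \<and>
     (\<forall>s r. 0 \<le> s \<longrightarrow> s \<le> r \<longrightarrow> r \<le> t \<longrightarrow>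
        (\<forall>v\<in>{s..r}. 0 < reflected p q n (gap_drive y0 \<beta>) L j v) \<longrightarrow> L j r = L j s)"
  proof (intro conjI allI impI ballI)
    show "L j 0 = 0" by (rule LT(1))
    show "continuous_on {0..t} (L j)" by (rule continuous_on_subset[OF L_cont]) auto
    show "mono_on {0..t} (L j)" by (rule mono_on_subset[OF LT(2)]) auto
    have "continuous_on {0..t} ?Z" by (rule continuous_on_subset[OF Z_cont]) auto
    then show "continuous_on {0..t} (reflected p q n (gap_drive y0 \<beta>) L j)"
      by (rule continuous_on_eq) (simp add: R)
    show "0 \<le> reflected p q n (gap_drive y0 \<beta>) L j s" if "s \<in> {0..t}" for s
      using ordered[OF j] R that by simp
    show "L j r = L j s" if sr: "0 \<le> s" "s \<le> r" "r \<le> t"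
      and pos: "\<forall>v\<in>{s..r}. 0 < reflected p q n (gap_drive y0 \<beta>) L j v" for s r
      by (rule LT(3)) (use sr pos R in auto)
  qed
qed

text \<open>\<open>D\<close> stands for V_eps', with \<open>D 0\<close> left arbitrary. The drift is
  integrable particle by particle, so the single interaction terms are first recovered along the
  chain; only then are the integrals \<open>A j\<close> meaningful. The level is \<epsilon> because
  the repulsion vanishes beyond it.\<close>

lemma repulsion_regulators:
  fixes xs :: "nat \<Rightarrow> real \<Rightarrow> real" and D :: "real \<Rightarrow> real"
  assumes pq: "p + q = 1" and t: "0 \<le> t"
    and D: "\<And>u. 0 < u \<Longrightarrow> D u \<le> 0" "\<And>u. \<epsilon> < u \<Longrightarrow> D u = 0" and \<epsilon>: "0 < \<epsilon>"
    and \<beta>: "\<And>j. j \<le> n \<Longrightarrow> continuous_on {0..} (\<beta> j)"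
    and rough: "\<And>j. j < n \<Longrightarrow> rough (\<lambda>s. \<beta> (Suc j) (max 0 s) - \<beta> j (max 0 s))"
    and ordered: "\<And>j s. \<lbrakk>j < n; 0 \<le> s\<rbrakk> \<Longrightarrow> xs j s \<le> xs (Suc j) s"
    and b_def: "\<And>j. b j = (\<lambda>s. (if j < n then p * D (xs (Suc j) s - xs j s) else 0)
                      - (if 0 < j then q * D (xs j s - xs (j - 1) s) else 0))"
    and b_int: "\<And>j s. \<lbrakk>j \<le> n; 0 \<le> s\<rbrakk> \<Longrightarrow> set_integrable lborel {0..s} (b j)"
    and eq: "\<And>j s. \<lbrakk>j \<le> n; 0 \<le> s\<rbrakk> \<Longrightarrow> xs j s = y0 j + (LINT r:{0..s}|lborel. b j r) + \<beta> j s"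
  obtains A where "regulators p q n t \<epsilon> (gap_drive y0 \<beta>) A"
    and "\<And>j s. \<lbrakk>j \<le> n; s \<in> {0..t}\<rbrakk> \<Longrightarrow> xs j s = pushed p q n y0 \<beta> A j s"
proof -
  define Z where "Z j s = xs (Suc j) s - xs j s" for j s
  define v where "v j s = D (Z j s)" for j s
  have b: "b j = (\<lambda>s. (if j < n then p * v j s else 0) - (if 0 < j then q * v (j - 1) s else 0))" for j
    unfolding b_def v_def Z_def by (cases j) auto
  have v_int: "\<forall>s\<ge>0. set_integrable lborel {0..s} (v j)" if j: "j < n" for j
  proof (rule chain_induct_either_end[OF pq, where P = "\<lambda>j. \<forall>s\<ge>0. set_integrable lborel {0..s} (v j)", OF _ _ j])
    fix j assume p: "p \<noteq> 0" and j: "j < n" and IH: "0 < j \<Longrightarrow> \<forall>s\<ge>0. set_integrable lborel {0..s} (v (j - 1))"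
    have "set_integrable lborel {0..s} (\<lambda>r. (1 / p) * (b j r + (if 0 < j then q * v (j - 1) r else 0)))" if "0 \<le> s" for s
      using IH b_int[of j s] j that
      by (cases "0 < j") (auto intro!: set_integral_add set_integrable_mult_right)
    moreover have "(\<lambda>r. (1 / p) * (b j r + (if 0 < j then q * v (j - 1) r else 0))) = v j"
      using j p by (auto simp: b fun_eq_iff)
    ultimately show "\<forall>s\<ge>0. set_integrable lborel {0..s} (v j)" by simp
  next
    fix j assume p: "p = 0" "q = 1" and j: "j < n"
    have "v j = (\<lambda>r. - 1 * b (Suc j) r)" using j p by (auto simp: b fun_eq_iff)
    then show "\<forall>s\<ge>0. set_integrable lborel {0..s} (v j)"
      using b_int[of "Suc j"] j by (metis Suc_leI set_integrable_mult_right)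
  qed
  have v_HK: "v j integrable_on {0..s}" if "j < n" "0 \<le> s" for j s
    using v_int[OF that(1)] that(2) set_borel_integral_eq_integral(1) by blast
  have b_HK: "b j integrable_on {0..s}" "(LINT r:{0..s}|lborel. b j r) = integral {0..s} (b j)"
    if "j \<le> n" "0 \<le> s" for j s
    using set_borel_integral_eq_integral[OF b_int[OF that]] by auto
  define A where "A j s = - integral {0..s} (v j)" for j s
  have eqA: "xs j s = pushed p q n y0 \<beta> A j s" if "j \<le> n" "0 \<le> s" for j s
  proof -
    have "integral {0..s} (b j) = integral {0..s} (\<lambda>s. if j < n then p * v j s else 0)
        - integral {0..s} (\<lambda>s. if 0 < j then q * v (j - 1) s else 0)"
      unfolding b using that v_HK[of j s] v_HK[of "j - 1" s]
      by (intro integral_diff) (cases "j < n"; cases "0 < j"; force intro: integrable_on_mult_right)+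
    also have "\<dots> = - (if j < n then p * A j s else 0) + (if 0 < j then q * A (j - 1) s else 0)"
      by (simp add: A_def)
    finally show ?thesis using eq[OF that] b_HK(2)[OF that] by (simp add: pushed_def)
  qed
  have R: "reflected p q n (gap_drive y0 \<beta>) A j s = Z j s" if "j < n" "0 \<le> s" for j s
    using pushed_gap[OF pq that(1), of y0 \<beta> A s] eqA[of j s] eqA[of "Suc j" s] that by (simp add: Z_def)
  have "regulators p q n t \<epsilon> (gap_drive y0 \<beta>) A"
    unfolding regulators_def
  proof (intro allI impI)
    fix j assume j: "j < n"
    have A_cont: "continuous_on {0..t} (A i)" if "i < n" for i
      unfolding A_def using v_HK[OF that t] by (intro continuous_intros indefinite_integral_continuous_1)
    have xs_cont: "continuous_on {0..t} (xs i)" if i: "i \<le> n" for i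
    proof -
      have "continuous_on {0..t} (\<lambda>s. if i < n then p * A i s else 0)"
        using A_cont[of i] by (cases "i < n") (auto intro!: continuous_intros)
      moreover have "continuous_on {0..t} (\<lambda>s. if 0 < i then q * A (i - 1) s else 0)"
        using A_cont[of "i - 1"] i by (cases "0 < i") (auto intro!: continuous_intros)
      moreover have "continuous_on {0..t} (\<beta> i)" by (rule continuous_on_subset[OF \<beta>[OF i]]) auto
      ultimately have "continuous_on {0..t} (pushed p q n y0 \<beta> A i)"
        unfolding pushed_def by (intro continuous_on_add continuous_on_diff continuous_on_const)
      then show ?thesis by (rule continuous_on_eq) (simp add: eqA[OF i])
    qed
    have Z_cont: "continuous_on {0..t} (Z j)"
      unfolding Z_def using j by (intro continuous_on_diff xs_cont) auto
    define f where "f s = b (Suc j) s - b j s" for s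
    have f_int: "set_integrable lborel {0..s} f" if "0 \<le> s" for s
      unfolding f_def using b_int that j by (intro set_integral_diff) auto
    \<comment> \<open>At contact the density of \<open>A j\<close> is \<open>- D 0\<close>, of
      unknown sign, so monotonicity of \<open>A j\<close> rests on this set being null. Lebesgue
      integrability of the drift supplies the integrable absolute value that the zero set lemma asks
      for.\<close>
    have "{s \<in> {0..t}. Z j s = 0} \<in> null_sets lborel"
    proof (rule rough_zero_set_null[OF rough[OF j] _ t])
      show "continuous_on UNIV (\<lambda>s. \<beta> (Suc j) (max 0 s) - \<beta> j (max 0 s))"
        using j \<beta> by (intro continuous_on_diff continuous_on_max0) auto
      show "f integrable_on {0..s}" if "0 \<le> s" for s
        using set_borel_integral_eq_integral(1)[OF f_int[OF that]] .
      show "(\<lambda>r. \<bar>f r\<bar>) integrable_on {0..s}" if "0 \<le> s" for s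
        using set_borel_integral_eq_integral(1)[OF set_integrable_abs[OF f_int[OF that]]] .
      show "Z j s = (y0 (Suc j) - y0 j) + (\<beta> (Suc j) (max 0 s) - \<beta> j (max 0 s)) + integral {0..s} f"
        if s: "s \<in> {0..t}" for s
      proof -
        have "integral {0..s} f = integral {0..s} (b (Suc j)) - integral {0..s} (b j)"
          unfolding f_def using s j by (intro integral_diff b_HK) auto
        then show ?thesis
          using eq[of j s] eq[of "Suc j" s] b_HK(2)[of j s] b_HK(2)[of "Suc j" s] s j by (simp add: Z_def)
      qed
    qed
    then have neg: "negligible {s \<in> {0..t}. Z j s = 0}"
      by (simp add: negligible_iff_null_sets null_sets_completionI)
    \<comment> \<open>Density of \<open>A j\<close> with the arbitrary value at contact replaced by
      0: nonnegative at all nonnegative times, with the same integrals.\<close>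
    define a where "a s = (if Z j s = 0 then 0 else - v j s)" for s
    have Z0: "0 \<le> Z j s" if "0 \<le> s" for s using ordered[OF j that] by (simp add: Z_def)
    have a0: "0 \<le> a s" if "0 \<le> s" for s
      using D(1)[of "Z j s"] Z0[OF that] by (auto simp: a_def v_def)
    have a_far: "a s = 0" if "\<epsilon> < Z j s" for s using D(2)[OF that] by (simp add: a_def v_def)
    have a_has: "(a has_integral A j s) {0..s}" if s: "s \<in> {0..t}" for s
    proof (rule has_integral_spike[OF neg])
      show "a r = - v j r" if "r \<in> {0..s} - {s \<in> {0..t}. Z j s = 0}" for r
        using that s by (auto simp: a_def)
      show "((\<lambda>r. - v j r) has_integral A j s) {0..s}"
        unfolding A_def using v_HK[OF j, of s] s by (intro has_integral_neg integrable_integral) auto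
    qed
    have a_incr: "(a has_integral (A j r - A j s)) {s..r}" if sr: "0 \<le> s" "s \<le> r" "r \<le> t" for s r
    proof -
      have r: "a integrable_on {0..r}" "integral {0..r} a = A j r"
        using a_has[of r] sr by (simp_all add: has_integral_iff)
      moreover have "integral {0..s} a = A j s"
        using a_has[of s] sr by (simp add: has_integral_iff)
      moreover have "a integrable_on {s..r}"
        by (rule integrable_on_subinterval[OF r(1)]) (use sr in auto)
      moreover have "integral {0..s} a + integral {s..r} a = integral {0..r} a"
        by (rule Henstock_Kurzweil_Integration.integral_combine[OF _ _ r(1)]) (use sr in auto)
      ultimately show ?thesis by (simp add: has_integral_iff)
    qed
    show "A j 0 = 0 \<and> continuous_on {0..t} (A j) \<and> mono_on {0..t} (A j) \<and>
       continuous_on {0..t} (reflected p q n (gap_drive y0 \<beta>) A j) \<and>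
       (\<forall>s\<in>{0..t}. 0 \<le> reflected p q n (gap_drive y0 \<beta>) A j s) \<and>
       (\<forall>s r. 0 \<le> s \<longrightarrow> s \<le> r \<longrightarrow> r \<le> t \<longrightarrow>
          (\<forall>v\<in>{s..r}. \<epsilon> < reflected p q n (gap_drive y0 \<beta>) A j v) \<longrightarrow> A j r = A j s)"
    proof (intro conjI allI impI ballI)
      show "A j 0 = 0" by (simp add: A_def)
      show "continuous_on {0..t} (A j)" using A_cont[OF j] .
      show "mono_on {0..t} (A j)"
      proof (rule mono_onI)
        fix s r assume "s \<in> {0..t}" "r \<in> {0..t}" "s \<le> r"
        then have "0 \<le> A j r - A j s"
          by (intro has_integral_nonneg[OF a_incr] a0) simp_all
        then show "A j s \<le> A j r" by simp
      qed
      show "continuous_on {0..t} (reflected p q n (gap_drive y0 \<beta>) A j)"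
        by (rule continuous_on_eq[OF Z_cont]) (simp add: R j)
      show "0 \<le> reflected p q n (gap_drive y0 \<beta>) A j s" if "s \<in> {0..t}" for s
        using Z0 R[OF j] that by simp
      show "A j r = A j s" if sr: "0 \<le> s" "s \<le> r" "r \<le> t"
        and far: "\<forall>v\<in>{s..r}. \<epsilon> < reflected p q n (gap_drive y0 \<beta>) A j v" for s r
      proof -
        have "a u = 0" if "u \<in> {s..r}" for u
          using bspec[OF far that] that sr R[OF j, of u] by (intro a_far) simp
        then have "(a has_integral 0) {s..r}" by (rule has_integral_is_0)
        with a_incr[OF sr] have "A j r - A j s = 0" by (rule has_integral_unique)
        then show ?thesis by simp
      qed
    qed
  qed
  then show ?thesis using eqA by (intro that) auto
qed

section \<open>What is used of the potential and of the Brownian motions\<close>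

lemma scaled_potential_deriv:
  fixes V :: "real \<Rightarrow> real"
  assumes V: "\<And>u. 0 < u \<Longrightarrow> V differentiable (at u)"
    and supp: "closure {u. u \<noteq> 0 \<and> V u \<noteq> 0} = {-1..1}"
    and decr: "\<And>u. 0 < u \<Longrightarrow> deriv V u \<le> 0" and \<epsilon>: "0 < \<epsilon>"
  shows "0 < u \<Longrightarrow> deriv (\<lambda>u. V (u / \<epsilon>)) u \<le> 0"
    and "\<epsilon> < u \<Longrightarrow> deriv (\<lambda>u. V (u / \<epsilon>)) u = 0"
proof -
  have *: "deriv (\<lambda>u. V (u / \<epsilon>)) u = deriv V (u / \<epsilon>) * (1 / \<epsilon>)" if "0 < u" for u
  proof (rule DERIV_imp_deriv, rule DERIV_chain2[where f = V and g = "\<lambda>u. u / \<epsilon>"])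
    show "(V has_real_derivative deriv V (u / \<epsilon>)) (at (u / \<epsilon>))"
      using V[of "u / \<epsilon>"] that \<epsilon> by (simp add: DERIV_deriv_iff_real_differentiable)
    show "((\<lambda>u. u / \<epsilon>) has_real_derivative 1 / \<epsilon>) (at u)"
      using \<epsilon> by (auto intro!: derivative_eq_intros)
  qed
  show "deriv (\<lambda>u. V (u / \<epsilon>)) u \<le> 0" if "0 < u"
    using *[OF that] decr[of "u / \<epsilon>"] that \<epsilon> by (simp add: divide_nonpos_pos)
  show "deriv (\<lambda>u. V (u / \<epsilon>)) u = 0" if u: "\<epsilon> < u"
  proof -
    have "V v = 0" if "1 < v" for v
    proof (rule ccontr)
      assume "V v \<noteq> 0"
      then have "v \<in> closure {u. u \<noteq> 0 \<and> V u \<noteq> 0}"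
        using that by (intro subsetD[OF closure_subset]) auto
      then show False using supp that by simp
    qed
    then have "eventually (\<lambda>v. V v = 0) (nhds (u / \<epsilon>))"
      using u \<epsilon> by (intro eventually_nhds_in_open[of "{1<..}", THEN eventually_mono]) auto
    then have "deriv V (u / \<epsilon>) = deriv (\<lambda>v. 0) (u / \<epsilon>)" by (intro deriv_cong_ev refl)
    then show ?thesis using *[of u] u \<epsilon> by simp
  qed
qed

text \<open>By independence of the two components an increment over h is centred normal with
  variance 2h, so the small-ball bound is a / sqrt(2h), below the required a / sqrt h. Freezing time
  at 0 with \<open>max 0\<close> makes the path continuous on the whole line.\<close>

lemma AE_rough_BM_difference:
  assumes M: "prob_space M" and B: "indep_std_BMs M n B" and j: "j < n"
  shows "AE \<omega> in M. rough (\<lambda>s. B (Suc j) (max 0 s) \<omega> - B j (max 0 s) \<omega>)"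
proof (rule AE_rough[OF M, where W = "\<lambda>s \<omega>. B (Suc j) (max 0 s) \<omega> - B j (max 0 s) \<omega>"])
  interpret prob_space M by fact
  have meas: "B i t \<in> borel_measurable M" if "i \<le> n" for i t
    using B that by (auto simp: indep_std_BMs_def)
  show "(\<lambda>\<omega>. B (Suc j) (max 0 t) \<omega> - B j (max 0 t) \<omega>) \<in> borel_measurable M" for t
    using meas j by (intro borel_measurable_diff) auto
  show "continuous_on UNIV (\<lambda>t. B (Suc j) (max 0 t) \<omega> - B j (max 0 t) \<omega>)" if "\<omega> \<in> space M" for \<omega>
  proof -
    have "continuous_on {0..} (\<lambda>t. B i t \<omega>)" if "i \<le> n" for i
      using B that \<open>\<omega> \<in> space M\<close> by (auto simp: indep_std_BMs_def)
    then show ?thesis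
      using j by (intro continuous_on_diff continuous_on_max0) auto
  qed
  fix s h a :: real assume s: "0 \<le> s" and h: "0 < h" and a: "0 \<le> a"
  \<comment> \<open>Grid with the single step from \<open>s\<close> to \<open>s + h\<close>:
    independence is used across particles only, not across time.\<close>
  define ts where "ts = (\<lambda>i. s + real i * h)"
  define X where "X = (\<lambda>ji \<omega>. B (fst ji) (ts (Suc (snd ji))) \<omega> - B (fst ji) (ts (snd ji)) \<omega> :: real)"
  have "0 \<le> ts 0 \<and> (\<forall>i<1. ts i < ts (Suc i))" using s h by (simp add: ts_def)
  then have iv: "indep_vars (\<lambda>_. borel) X ({..n} \<times> {..<1})"
    and nd: "\<forall>i\<le>n. \<forall>k<1. distributed M lborel (\<lambda>\<omega>. B i (ts (Suc k)) \<omega> - B i (ts k) \<omega>)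
             (\<lambda>z. ennreal (normal_density 0 (sqrt (ts (Suc k) - ts k)) z))"
    using B unfolding indep_std_BMs_def X_def by blast+
  have norm: "distributed M lborel (X (i, 0)) (normal_density 0 (sqrt h))" if "i \<le> n" for i
    using nd[rule_format, of i 0] that by (simp add: X_def ts_def)
  have "indep_vars (\<lambda>_. borel) X (insert (Suc j, 0) {(j, 0)})"
    by (rule indep_vars_subset[OF iv]) (use j in auto)
  then have "indep_var borel (X (Suc j, 0)) borel (\<lambda>\<omega>. \<Sum>i\<in>{(j, 0)}. X i \<omega>)"
    by (intro indep_vars_sum) auto
  then have "indep_var borel (X (Suc j, 0)) borel (X (j, 0))" by simp
  then have "distributed M lborel (\<lambda>\<omega>. X (Suc j, 0) \<omega> - X (j, 0) \<omega>)
      (normal_density (0 - 0) (sqrt ((sqrt h)\<^sup>2 + (sqrt h)\<^sup>2)))"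
    by (rule diff_indep_normal) (use norm j h in auto)
  then have "distributed M lborel (\<lambda>\<omega>. X (Suc j, 0) \<omega> - X (j, 0) \<omega>) (normal_density 0 (sqrt (h + h)))"
    using h by simp
  from normal_small_ball[OF this _ a] h
  have "emeasure M {\<omega> \<in> space M. \<bar>X (Suc j, 0) \<omega> - X (j, 0) \<omega>\<bar> \<le> a} \<le> ennreal (a / sqrt (h + h))"
    by simp
  also have "\<dots> \<le> ennreal (a / sqrt h)"
    using h a by (intro ennreal_leI divide_left_mono) auto
  also have "(\<lambda>\<omega>. X (Suc j, 0) \<omega> - X (j, 0) \<omega>) = (\<lambda>\<omega>. (B (Suc j) (max 0 (s + h)) \<omega> - B j (max 0 (s + h)) \<omega>)
       - (B (Suc j) (max 0 s) \<omega> - B j (max 0 s) \<omega>))"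
    using s h by (auto simp: X_def ts_def)
  then have "{\<omega> \<in> space M. \<bar>X (Suc j, 0) \<omega> - X (j, 0) \<omega>\<bar> \<le> a}
      = {\<omega> \<in> space M. \<bar>(B (Suc j) (max 0 (s + h)) \<omega> - B j (max 0 (s + h)) \<omega>)
       - (B (Suc j) (max 0 s) \<omega> - B j (max 0 s) \<omega>)\<bar> \<le> a}"
    by (simp add: fun_eq_iff)
  finally show "emeasure M {\<omega> \<in> space M. \<bar>(B (Suc j) (max 0 (s + h)) \<omega> - B j (max 0 (s + h)) \<omega>)
       - (B (Suc j) (max 0 s) \<omega> - B j (max 0 s) \<omega>)\<bar> \<le> a} \<le> ennreal (a / sqrt h)" .
qed

section \<open>The almost sure bound and the limit in mean square\<close>

theorem theoremB12:
  fixes M :: "'a measure"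
    and n :: nat and p q :: real
    and V :: "real \<Rightarrow> real"
    and B :: "nat \<Rightarrow> real \<Rightarrow> 'a \<Rightarrow> real"
    and x :: "real \<Rightarrow> nat \<Rightarrow> real \<Rightarrow> 'a \<Rightarrow> real"
    and y :: "nat \<Rightarrow> real \<Rightarrow> 'a \<Rightarrow> real"
    and \<Lambda> :: "nat \<Rightarrow> real \<Rightarrow> 'a \<Rightarrow> real"
    and y0 :: "nat \<Rightarrow> real"
  assumes M: "prob_space M"
    and pq: "p + q = 1" "0 \<le> p" "p \<le> 1"
    and n: "n \<ge> 1"
    and V_nonneg: "\<forall>u. u \<noteq> 0 \<longrightarrow> 0 \<le> V u"
    and V_C2: "\<forall>u. u \<noteq> 0 \<longrightarrow> V differentiable (at u) \<and> deriv V differentiable (at u)"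
    and V_C2': "continuous_on (- {0}) (deriv (deriv V))"
    and V_even: "\<forall>u. V u = V (- u)"
    and V_supp: "closure {u. u \<noteq> 0 \<and> V u \<noteq> 0} = {-1..1}"
    and V_decr: "\<forall>u>0. deriv V u \<le> 0"
    and V_sing: "\<exists>\<delta>>0. \<exists>c>0. ((\<lambda>u. \<bar>u\<bar> powr \<delta> * V u) \<longlongrightarrow> c) (at 0)"
    and BM: "indep_std_BMs M n B"
    and y0: "y0 \<in> weyl_chamber n"
    and x_sol: "\<forall>\<epsilon>>0. AE \<omega> in M. \<forall>t\<ge>0.
        (\<lambda>j. x \<epsilon> j t \<omega>) \<in> weyl_chamber n \<and>
        (\<forall>j\<le>n.
          (let b = (\<lambda>s. (if j < n then p * deriv (\<lambda>u. V (u / \<epsilon>)) (x \<epsilon> (Suc j) s \<omega> - x \<epsilon> j s \<omega>) else 0)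
                      - (if 0 < j then q * deriv (\<lambda>u. V (u / \<epsilon>)) (x \<epsilon> j s \<omega> - x \<epsilon> (j - 1) s \<omega>) else 0))
           in set_integrable lborel {0..t} b \<and>
              x \<epsilon> j t \<omega> = y0 j + (LINT s:{0..t}|lborel. b s) + B j t \<omega>))"
    and x_meas: "\<forall>\<epsilon>>0. \<forall>j\<le>n. \<forall>t. x \<epsilon> j t \<in> borel_measurable M"
    and y_sol: "AE \<omega> in M. \<forall>t\<ge>0.
        (\<lambda>j. y j t \<omega>) \<in> weyl_chamber n \<and>
        (\<forall>j\<le>n. continuous_on {0..} (\<lambda>s. y j s \<omega>)) \<and>
        (\<forall>j<n. is_right_local_time_0 (\<lambda>s. y (Suc j) s \<omega> - y j s \<omega>) t (\<Lambda> j t \<omega>)) \<and>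
        (\<forall>j\<le>n. y j t \<omega> = y0 j + B j t \<omega>
             - (if j < n then p * \<Lambda> j t \<omega> else 0)
             + (if 0 < j then q * \<Lambda> (j - 1) t \<omega> else 0))"
    and y_meas: "\<forall>j\<le>n. \<forall>t. y j t \<in> borel_measurable M"
  shows "\<forall>t\<ge>0. ((\<lambda>\<epsilon>. \<integral>\<^sup>+ \<omega>. ennreal (\<Sum>j\<le>n. (x \<epsilon> j t \<omega> - y j t \<omega>)\<^sup>2) \<partial>M)
                   \<longlongrightarrow> 0) (at_right 0)"
proof (intro allI impI)
  fix t :: real assume t: "0 \<le> t"
  obtain u where u: "\<And>j. j < n \<Longrightarrow> 0 < u j"
      "\<And>j. j < n \<Longrightarrow> 1 + (if Suc j < n then p * u (Suc j) else 0) + (if 0 < j then q * u (j - 1) else 0) \<le> u j"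
    using superharmonic_weights[OF pq, of n] by blast
  \<comment> \<open>Particle \<open>j\<close> feels the regulator errors of its two adjacent gaps,
    each at most \<open>\<epsilon>\<close> times the weight, with coefficients \<open>p\<close> and
    \<open>q\<close>.\<close>
  define C where "C j = (if j < n then p * u j else 0) + (if 0 < j then q * u (j - 1) else 0)" for j
  have q0: "0 \<le> q" using pq by simp
  have B_cont: "continuous_on {0..} (\<lambda>s. B j s \<omega>)" if "j \<le> n" "\<omega> \<in> space M" for j \<omega>
    using BM that by (auto simp: indep_std_BMs_def)
  have B_rough: "AE \<omega> in M. \<forall>j\<in>{..<n}. rough (\<lambda>s. B (Suc j) (max 0 s) \<omega> - B j (max 0 s) \<omega>)"
    by (rule AE_finite_allI) (auto intro: AE_rough_BM_difference[OF M BM])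
  \<comment> \<open>The exceptional null set may depend on \<epsilon>. This is harmless, since the
    expectation is bounded for each \<epsilon> separately before the limit is taken.\<close>
  have close: "AE \<omega> in M. \<forall>j\<le>n. \<bar>x \<epsilon> j t \<omega> - y j t \<omega>\<bar> \<le> \<epsilon> * C j" if \<epsilon>: "0 < \<epsilon>" for \<epsilon>
    using x_sol[rule_format, OF \<epsilon>] y_sol B_rough AE_space
  proof eventually_elim
    case (elim \<omega>)
    define \<beta> where "\<beta> j s = B j s \<omega>" for j s
    define D where "D = deriv (\<lambda>u. V (u / \<epsilon>))"
    define b where "b j = (\<lambda>s. (if j < n then p * D (x \<epsilon> (Suc j) s \<omega> - x \<epsilon> j s \<omega>) else 0)
                      - (if 0 < j then q * D (x \<epsilon> j s \<omega> - x \<epsilon> (j - 1) s \<omega>) else 0))" for j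
    have \<beta>: "continuous_on {0..} (\<beta> j)" if "j \<le> n" for j
      using B_cont[OF that elim(4)] by (simp add: \<beta>_def)
    have xs: "j < n \<Longrightarrow> x \<epsilon> j s \<omega> \<le> x \<epsilon> (Suc j) s \<omega>"
        "j \<le> n \<Longrightarrow> set_integrable lborel {0..s} (b j)"
        "j \<le> n \<Longrightarrow> x \<epsilon> j s \<omega> = y0 j + (LINT r:{0..s}|lborel. b j r) + \<beta> j s" if "0 \<le> s" for j s
      using elim(1)[rule_format, OF that] unfolding weyl_chamber_def Let_def b_def D_def \<beta>_def by blast+
    have ys: "j < n \<Longrightarrow> y j s \<omega> \<le> y (Suc j) s \<omega>"
        "j \<le> n \<Longrightarrow> continuous_on {0..} (\<lambda>s. y j s \<omega>)"
        "j < n \<Longrightarrow> is_right_local_time_0 (\<lambda>s. y (Suc j) s \<omega> - y j s \<omega>) s (\<Lambda> j s \<omega>)"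
        "j \<le> n \<Longrightarrow> y j s \<omega> = pushed p q n y0 \<beta> (\<lambda>j s. \<Lambda> j s \<omega>) j s" if "0 \<le> s" for j s
      using elim(2)[rule_format, OF that] unfolding weyl_chamber_def pushed_def \<beta>_def by blast+
    have Dsign: "D v \<le> 0" if "0 < v" for v
      unfolding D_def using V_C2 V_decr that by (intro scaled_potential_deriv(1)[OF _ V_supp _ \<epsilon>]) auto
    have Dsupp: "D v = 0" if "\<epsilon> < v" for v
      unfolding D_def using V_C2 V_decr that by (intro scaled_potential_deriv(2)[OF _ V_supp _ \<epsilon>]) auto
    obtain A where A: "regulators p q n t \<epsilon> (gap_drive y0 \<beta>) A"
      and xA: "\<And>j s. \<lbrakk>j \<le> n; s \<in> {0..t}\<rbrakk> \<Longrightarrow> x \<epsilon> j s \<omega> = pushed p q n y0 \<beta> A j s"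
    proof (rule repulsion_regulators[where xs = "\<lambda>j s. x \<epsilon> j s \<omega>" and b = b and D = D and \<epsilon> = \<epsilon>
          and \<beta> = \<beta> and ?y0.0 = y0, OF pq(1) t Dsign Dsupp \<epsilon> \<beta>])
      show "rough (\<lambda>s. \<beta> (Suc j) (max 0 s) - \<beta> j (max 0 s))" if "j < n" for j
        using elim(3) that by (simp add: \<beta>_def)
    qed (use xs b_def in auto)
    have L: "regulators p q n t 0 (gap_drive y0 \<beta>) (\<lambda>j s. \<Lambda> j s \<omega>)"
      by (rule local_time_regulators[where ys = "\<lambda>j s. y j s \<omega>", OF pq(1) t \<beta>]) (use ys in auto)
    have AL: "\<bar>A j t - \<Lambda> j t \<omega>\<bar> \<le> \<epsilon> * u j" if "j < n" for j
      using regulators_close[OF pq(2) q0 t _ A L u that, of t] t \<epsilon> by simp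
    show ?case
    proof (intro allI impI)
      fix j assume j: "j \<le> n"
      have "x \<epsilon> j t \<omega> - y j t \<omega> = - (if j < n then p * (A j t - \<Lambda> j t \<omega>) else 0)
          + (if 0 < j then q * (A (j - 1) t - \<Lambda> (j - 1) t \<omega>) else 0)"
        using xA[OF j, of t] ys(4)[OF t j] t
        by (cases "j < n"; cases "0 < j") (simp_all add: pushed_def right_diff_distrib)
      moreover have "\<bar>if j < n then p * (A j t - \<Lambda> j t \<omega>) else 0\<bar> \<le> (if j < n then p * (\<epsilon> * u j) else 0)"
        using AL[of j] pq by (simp add: abs_mult mult_left_mono)
      moreover have "\<bar>if 0 < j then q * (A (j - 1) t - \<Lambda> (j - 1) t \<omega>) else 0\<bar>
          \<le> (if 0 < j then q * (\<epsilon> * u (j - 1)) else 0)"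
        using AL[of "j - 1"] j q0 by (simp add: abs_mult mult_left_mono)
      moreover have "\<epsilon> * C j = (if j < n then p * (\<epsilon> * u j) else 0) + (if 0 < j then q * (\<epsilon> * u (j - 1)) else 0)"
        by (simp add: C_def algebra_simps)
      ultimately show "\<bar>x \<epsilon> j t \<omega> - y j t \<omega>\<bar> \<le> \<epsilon> * C j" by linarith
    qed
  qed
  have bound: "(\<integral>\<^sup>+ \<omega>. ennreal (\<Sum>j\<le>n. (x \<epsilon> j t \<omega> - y j t \<omega>)\<^sup>2) \<partial>M) \<le> ennreal (\<Sum>j\<le>n. (\<epsilon> * C j)\<^sup>2)"
    if \<epsilon>: "0 < \<epsilon>" for \<epsilon>
  proof -
    have "(\<integral>\<^sup>+ \<omega>. ennreal (\<Sum>j\<le>n. (x \<epsilon> j t \<omega> - y j t \<omega>)\<^sup>2) \<partial>M)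
        \<le> (\<integral>\<^sup>+ \<omega>. ennreal (\<Sum>j\<le>n. (\<epsilon> * C j)\<^sup>2) \<partial>M)"
      using close[OF \<epsilon>]
      by (intro nn_integral_mono_AE, eventually_elim)
         (auto intro!: ennreal_leI sum_mono simp: abs_le_square_iff[symmetric] intro: order_trans[OF _ abs_ge_self])
    then show ?thesis
      using prob_space.emeasure_space_1[OF M] by simp
  qed
  show "((\<lambda>\<epsilon>. \<integral>\<^sup>+ \<omega>. ennreal (\<Sum>j\<le>n. (x \<epsilon> j t \<omega> - y j t \<omega>)\<^sup>2) \<partial>M) \<longlongrightarrow> 0) (at_right 0)"
  proof (rule tendsto_sandwich[OF _ _ tendsto_const])
    have "((\<lambda>\<epsilon>. ennreal (\<Sum>j\<le>n. (\<epsilon> * C j)\<^sup>2)) \<longlongrightarrow> ennreal (\<Sum>j\<le>n. (0 * C j)\<^sup>2)) (at_right 0)"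
      by (intro tendsto_ennrealI tendsto_intros)
    then show "((\<lambda>\<epsilon>. ennreal (\<Sum>j\<le>n. (\<epsilon> * C j)\<^sup>2)) \<longlongrightarrow> 0) (at_right 0)" by simp
    show "\<forall>\<^sub>F \<epsilon> in at_right 0. (\<integral>\<^sup>+ \<omega>. ennreal (\<Sum>j\<le>n. (x \<epsilon> j t \<omega> - y j t \<omega>)\<^sup>2) \<partial>M)
        \<le> ennreal (\<Sum>j\<le>n. (\<epsilon> * C j)\<^sup>2)"
      by (rule eventually_mono[OF eventually_at_right_less bound])
  qed simp
qed

end
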